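(* There exists $N\in\mathcal{LC}$, with quotient sequence $\nu_p:=N_p/N_{p-1}$, such that $N$ violates the condition $$(\ast)\qquad \exists\, d\in\mathbb{N}_{>0}\ \exists\, A\ge 1\ \forall\, p\in\mathbb{N}_{>0}:\quad \nu_p\le A\,(N_{dp})^{1/(dp)},$$ i.e. $g(N)=+\infty$. This is equivalent to the fact that the matrix $\mathcal{M}_{\omega_N}$ associated with $\omega_N$ does not have the quotient/root comparison property of Roumieu type, and also equivalent to the fact that it does not have the quotient/root comparison property of Beurling type. In particular, $N$ violates moderate growth, equivalently $\mathcal{M}_{\omega_N}$ is non-constant. In addition, one can obtain the following further properties: (a) $N$ (violating $(\ast)$) can be chosen to be strongly non-quasianalytic, i.e. such that $$\exists\, Q\in\mathbb{N},\ Q\ge 2:\quad \liminf_{p\to+\infty}\frac{\nu_{Qp}}{\nu_p}>Q.$$ In this case $\omega_N$ also satisfies $$\exists\, C\ge 1\ \forall\, y\ge 0:\quad \int_1^{+\infty}\frac{\omega_N(yt)}{t^2}\,dt\le C\omega_N(y)+C,$$ i.e. $\omega_N$ is even a strong weight. On the other hand, $N$ (violating $(\ast)$) can also be chosen to be quasianalytic, i.e. such that $\sum_{p\ge 1}\frac{1}{\nu_p}=+\infty$. (b) $N$ can be chosen such that even the following condition is violated: $$\exists\, d\in\mathbb{N}_{>0}\ \exists\, A,C\ge 1\ \forall\, p\in\mathbb{N}_{>0}:\quad \nu_p\le A\,C^{2p}\,(N_{dp})^{1/(dp)}.$$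
   Context: $\mathbb{N}=\{0,1,2,\dots\}$, $\mathbb{N}_{>0}=\{1,2,\dots\}$. $\mathcal{LC}$ denotes the set of all sequences $M=(M_p)_{p\in\mathbb{N}}$ of positive reals with $1=M_0\le M_1$, $M_p^2\le M_{p-1}M_{p+1}$ for all $p\ge1$ (log-convexity), and $\lim_{p\to+\infty}(M_p)^{1/p}=+\infty$. For such $M$ put $\mu_p:=M_p/M_{p-1}$ for $p\ge 1$, $\mu_0:=1$ (and analogously $\nu$ for $N$, $\mu^{(l)}$ for $M^{(l)}$, etc.). Associated weight function: $\omega_M(t):=\sup_{p\in\mathbb{N}}\log(t^p/M_p)$ for $t>0$, $\omega_M(0):=0$. Associated weight matrix: with $\varphi_{\omega_M}(t):=\omega_M(e^t)$ and $\varphi^*_{\omega_M}(x):=\sup\{xy-\varphi_{\omega_M}(y):y\ge 0\}$ for $x\ge 0$, put $\mathcal{M}_{\omega_M}:=\{M^{(l)}:l>0\}$, $M^{(l)}_p:=\exp\big(\tfrac1l\varphi^*_{\omega_M}(lp)\big)$, $p\in\mathbb{N}$. A matrix $\{M^{(x)}:x>0\}$ has the quotient/root comparison property of Roumieu type if $\forall x>0\ \exists y>0\ \exists A\ge 1\ \forall p\in\mathbb{N}_{>0}:\ \mu^{(x)}_p\le A(M^{(y)}_p)^{1/p}$, and of Beurling type if $\forall x>0\ \exists y>0\ \exists A\ge 1\ \forall p\in\mathbb{N}_{>0}:\ \mu^{(y)}_p\le A(M^{(x)}_p)^{1/p}$. Moderate growth of $M$: $\exists C\ge 1\ \forall p,q\in\mathbb{N}:\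 M_{p+q}\le C^{p+q}M_pM_q$. Equivalence of sequences $M\approx N$: $\sup_{p\ge1}(M_p/N_p)^{1/p}<+\infty$ and $\sup_{p\ge1}(N_p/M_p)^{1/p}<+\infty$. A matrix is constant if all its members are pairwise equivalent. Moderate growth index: $g(M):=\min\{d\in\mathbb{N}_{>0}:\ \exists A\ge1\ \forall p\in\mathbb{N}_{>0}:\ \mu_p\le A(M_{dp})^{1/(dp)}\}$, and $g(M):=+\infty$ if no such $d$ exists. "Strong weight" means a weight function satisfying the integral condition displayed in (a). *)

theory Defs
  imports "HOL-Analysis.Analysis"
begin

definition LC :: "(nat \<Rightarrow> real) set" where
  "LC = {M. (\<forall>p. M p > 0) \<and> M 0 = 1 \<and> 1 \<le> M 1 \<and>
            (\<forall>p\<ge>1. (M p)\<^sup>2 \<le> M (p - 1) * M (p + 1)) \<and>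
            filterlim (\<lambda>p. M p powr (1 / real p)) at_top sequentially}"

definition quot :: "(nat \<Rightarrow> real) \<Rightarrow> nat \<Rightarrow> real" where
  "quot M p = (if p = 0 then 1 else M p / M (p - 1))"

text \<open>For \<open>M \<in> LC\<close> the suprema in the next two definitions are over sets that are bounded above
  (for the conjugate, when \<open>x \<ge> 0\<close>), so the real-valued supremum is the intended one.\<close>

definition assoc_weight :: "(nat \<Rightarrow> real) \<Rightarrow> real \<Rightarrow> real" where
  "assoc_weight M t = (if t > 0 then (SUP p. ln (t ^ p / M p)) else 0)"

definition young_conj :: "(real \<Rightarrow> real) \<Rightarrow> real \<Rightarrow> real" where
  "young_conj \<phi> x = (SUP y\<in>{0..}. x * y - \<phi> y)"

text \<open>A weight matrix is a family \<open>M :: real \<Rightarrow> nat \<Rightarrow> real\<close> of sequences, of which only the members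
  with positive index are considered.\<close>

definition weight_matrix :: "(real \<Rightarrow> real) \<Rightarrow> real \<Rightarrow> nat \<Rightarrow> real" where
  "weight_matrix \<omega> l p = exp (1 / l * young_conj (\<lambda>y. \<omega> (exp y)) (l * real p))"

definition quot_root_Roumieu :: "(real \<Rightarrow> nat \<Rightarrow> real) \<Rightarrow> bool" where
  "quot_root_Roumieu M \<longleftrightarrow>
     (\<forall>x>0. \<exists>y>0. \<exists>A\<ge>1. \<forall>p>0. quot (M x) p \<le> A * M y p powr (1 / real p))"

definition quot_root_Beurling :: "(real \<Rightarrow> nat \<Rightarrow> real) \<Rightarrow> bool" where
  "quot_root_Beurling M \<longleftrightarrow>
     (\<forall>x>0. \<exists>y>0. \<exists>A\<ge>1. \<forall>p>0. quot (M y) p \<le> A * M x p powr (1 / real p))"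

definition moderate_growth :: "(nat \<Rightarrow> real) \<Rightarrow> bool" where
  "moderate_growth M \<longleftrightarrow> (\<exists>C\<ge>1. \<forall>p q. M (p + q) \<le> C ^ (p + q) * M p * M q)"

definition seq_equiv :: "(nat \<Rightarrow> real) \<Rightarrow> (nat \<Rightarrow> real) \<Rightarrow> bool" where
  "seq_equiv M N \<longleftrightarrow>
     bdd_above ((\<lambda>p. (M p / N p) powr (1 / real p)) ` {1..}) \<and>
     bdd_above ((\<lambda>p. (N p / M p) powr (1 / real p)) ` {1..})"

definition constant_matrix :: "(real \<Rightarrow> nat \<Rightarrow> real) \<Rightarrow> bool" where
  "constant_matrix M \<longleftrightarrow> (\<forall>x>0. \<forall>y>0. seq_equiv (M x) (M y))"

definition quot_root_at :: "(nat \<Rightarrow> real) \<Rightarrow> nat \<Rightarrow> bool" where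
  "quot_root_at M d \<longleftrightarrow>
     (\<exists>A\<ge>1. \<forall>p>0. quot M p \<le> A * M (d * p) powr (1 / real (d * p)))"

definition mg_index :: "(nat \<Rightarrow> real) \<Rightarrow> enat" where
  "mg_index M = (if \<exists>d>0. quot_root_at M d
                 then enat (LEAST d. d > 0 \<and> quot_root_at M d) else \<infinity>)"

definition quot_root_cond :: "(nat \<Rightarrow> real) \<Rightarrow> bool" where
  "quot_root_cond N \<longleftrightarrow>
     (\<exists>d>0. \<exists>A\<ge>1. \<forall>p>0. quot N p \<le> A * N (d * p) powr (1 / real (d * p)))"

definition weak_quot_root_cond :: "(nat \<Rightarrow> real) \<Rightarrow> bool" where
  "weak_quot_root_cond N \<longleftrightarrow>
     (\<exists>d>0. \<exists>A\<ge>1. \<exists>C\<ge>1. \<forall>p>0.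
        quot N p \<le> A * C ^ (2 * p) * N (d * p) powr (1 / real (d * p)))"

definition strongly_nonquasianalytic :: "(nat \<Rightarrow> real) \<Rightarrow> bool" where
  "strongly_nonquasianalytic N \<longleftrightarrow>
     (\<exists>Q\<ge>2. liminf (\<lambda>p. ereal (quot N (Q * p) / quot N p)) > ereal (real Q))"

definition quasianalytic :: "(nat \<Rightarrow> real) \<Rightarrow> bool" where
  "quasianalytic N \<longleftrightarrow> filterlim (\<lambda>n. \<Sum>p=1..n. 1 / quot N p) at_top sequentially"

definition weight_function :: "(real \<Rightarrow> real) \<Rightarrow> bool" where
  "weight_function \<omega> \<longleftrightarrow>
     continuous_on {0..} \<omega> \<and> mono_on {0..} \<omega> \<and> \<omega> 0 = 0 \<and> filterlim \<omega> at_top at_top"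

text \<open>A weight function is nonnegative on \<open>{0..}\<close>, so the integral of its \<open>ennreal\<close>-valued
  version is the intended one; the bound includes finiteness of the integral.\<close>

definition strong_weight :: "(real \<Rightarrow> real) \<Rightarrow> bool" where
  "strong_weight \<omega> \<longleftrightarrow> weight_function \<omega> \<and>
     (\<exists>C\<ge>1. \<forall>y\<ge>0.
        (\<integral>\<^sup>+t\<in>{1..}. ennreal (\<omega> (y * t) / t\<^sup>2) \<partial>lborel) \<le> ennreal (C * \<omega> y + C))"

end

(* Write psi for the Young conjugate of t \<mapsto> omega_N(e^t).  It is convex and interpolates log N on the
   naturals, so the members of the matrix are N^(l)_p = exp (psi (l p) / l): their quotients are
   slopes of psi over [l (p - 1), l p] and their roots are the mean slopes psi(l p) / (l p).  All
   growth conditions on N and on its matrix thus compare slopes of one convex function, and the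
   equivalences follow from the monotonicity of its slopes.

   Strong non-quasianalyticity gives omega_N(K t) \<le> q omega_N(t) + D with 1 < q < K, hence
   omega_N(y t) \<le> A (omega_N(y) + B) t^alpha with alpha < 1, which is integrable against t^(-2).

   The counterexamples have log nu_p = c log p + (plateau p)^2, where plateau is a step function
   whose steps have extremely long plateaus: the long plateaus give quasianalyticity (c = 0), the
   jumps violate the growth conditions, and the term 2 log p gives strong
   non-quasianalyticity (c = 2). *)

theory Submission imports Defs begin

section \<open>Slopes and suprema of convex functions, with elementary bounds\<close>

text \<open>Both slopes are compared with the slope over \<open>[a, d]\<close>, which shares an
  endpoint with each interval, so the two intervals may overlap.\<close>

lemma convex_on_slope_mono:
  fixes f :: "real \<Rightarrow> real"
  assumes f: "convex_on S f" and S: "a \<in> S" "b \<in> S" "c \<in> S" "d \<in> S"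
    and le: "a < b" "c < d" "a \<le> c" "b \<le> d"
  shows "(f b - f a) / (b - a) \<le> (f d - f c) / (d - c)"
proof -
  have "(f b - f a) / (b - a) \<le> (f d - f a) / (d - a)"
  proof (cases "b = d")
    case False
    then show ?thesis
      using convex_on_slope_le(1)[OF f, of a d b] S le
      by (smt (verit) minus_diff_eq minus_divide_divide)
  qed simp
  also have "\<dots> \<le> (f d - f c) / (d - c)"
  proof (cases "a = c")
    case False
    then show ?thesis
      using convex_on_slope_le(2)[OF f, of a d c] S le
      by (smt (verit) minus_diff_eq minus_divide_divide)
  qed simp
  finally show ?thesis .
qed

text \<open>Serves two suprema of affine functions: the Young conjugate, and the associated weight
  in the variable \<open>ln t\<close>.\<close>

lemma convex_on_SUP:
  fixes f :: "'i \<Rightarrow> real \<Rightarrow> real"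
  assumes S: "convex S" and I: "I \<noteq> {}"
    and f: "\<And>i. i \<in> I \<Longrightarrow> convex_on S (f i)"
    and bdd: "\<And>x. x \<in> S \<Longrightarrow> bdd_above ((\<lambda>i. f i x) ` I)"
  shows "convex_on S (\<lambda>x. SUP i\<in>I. f i x)"
proof (rule convex_onI[OF _ S])
  fix t x y :: real
  assume t: "0 < t" "t < 1" and xy: "x \<in> S" "y \<in> S"
  show "(SUP i\<in>I. f i ((1 - t) *\<^sub>R x + t *\<^sub>R y)) \<le> (1 - t) * (SUP i\<in>I. f i x) + t * (SUP i\<in>I. f i y)"
  proof (rule cSUP_least[OF I])
    fix i assume i: "i \<in> I"
    have "f i ((1 - t) *\<^sub>R x + t *\<^sub>R y) \<le> (1 - t) * f i x + t * f i y"
      using convex_onD[OF f[OF i], of t x y] t xy by simp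
    also have "\<dots> \<le> (1 - t) * (SUP i\<in>I. f i x) + t * (SUP i\<in>I. f i y)"
      using t by (intro add_mono mult_left_mono cSUP_upper i bdd xy) auto
    finally show "f i ((1 - t) *\<^sub>R x + t *\<^sub>R y) \<le> \<dots>" .
  qed
qed

lemma finite_bounds_above:
  fixes f :: "nat \<Rightarrow> real"
  obtains B where "B \<ge> 0" "\<And>p. p \<le> n \<Longrightarrow> f p \<le> B"
proof
  show "(\<Sum>p\<le>n. \<bar>f p\<bar>) \<ge> 0" by (simp add: sum_nonneg)
  show "f p \<le> (\<Sum>p\<le>n. \<bar>f p\<bar>)" if "p \<le> n" for p
    using member_le_sum[of p "{..n}" "\<lambda>p. \<bar>f p\<bar>"] that by simp
qed

lemma nat_ceiling_bounds:
  fixes x :: real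
  assumes "0 \<le> x"
  shows "x \<le> real (nat \<lceil>x\<rceil>)" "real (nat \<lceil>x\<rceil>) \<le> x + 1"
  using assms by linarith+

lemma nn_integral_powr_atLeast_1:
  assumes "c \<ge> 0" "\<alpha> < 1"
  shows "(\<integral>\<^sup>+t\<in>{1..}. ennreal (c * t powr (\<alpha> - 2)) \<partial>lborel) = ennreal (c / (1 - \<alpha>))"
proof -
  have "(\<integral>\<^sup>+t. ennreal (c * t powr (\<alpha> - 2)) * indicator {1..} t \<partial>lborel)
      = ennreal (0 - c / (\<alpha> - 1) * 1 powr (\<alpha> - 1))"
  proof (rule nn_integral_FTC_atLeast[where F = "\<lambda>t. c / (\<alpha> - 1) * t powr (\<alpha> - 1)"])
    fix t :: real assume t: "1 \<le> t"
    have "DERIV (\<lambda>t. t powr (\<alpha> - 1)) t :> (\<alpha> - 1) * t powr (\<alpha> - 1 - 1)"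
      using t by (intro has_real_derivative_powr) simp
    from DERIV_cmult[OF this, of "c / (\<alpha> - 1)"]
    show "DERIV (\<lambda>t. c / (\<alpha> - 1) * t powr (\<alpha> - 1)) t :> c * t powr (\<alpha> - 2)"
      using assms by simp
  next
    have "((\<lambda>t. t powr (\<alpha> - 1)) \<longlongrightarrow> 0) (at_top :: real filter)"
      using assms by (intro tendsto_neg_powr filterlim_ident) auto
    then show "((\<lambda>t. c / (\<alpha> - 1) * t powr (\<alpha> - 1)) \<longlongrightarrow> 0) (at_top :: real filter)"
      by (rule tendsto_mult_right_zero)
  qed (use assms in auto)
  also have "0 - c / (\<alpha> - 1) * 1 powr (\<alpha> - 1) = c / (1 - \<alpha>)"
    using assms by (simp add: field_simps)
  finally show ?thesis .
qed

section \<open>Quotients and logarithms of a sequence in \<open>LC\<close>\<close>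

context
  fixes M :: "nat \<Rightarrow> real"
  assumes M: "M \<in> LC"
begin

lemma LC_pos: "M p > 0" and LC_0: "M 0 = 1" and LC_1: "1 \<le> M 1"
  using M by (auto simp: LC_def)

lemma LC_nonzero: "M p \<noteq> 0"
  using LC_pos[of p] by simp

lemma quot_pos: "quot M p > 0"
  by (simp add: quot_def LC_pos)

text \<open>This is log-convexity divided by positive terms; at \<open>p = 0\<close> it is the
  normalisation \<open>1 \<le> M 1\<close> under the convention \<open>quot M 0 = 1\<close>.\<close>

lemma quot_Suc_mono: "quot M p \<le> quot M (Suc p)"
proof (cases p)
  case (Suc k)
  have "(M (Suc k))\<^sup>2 \<le> M k * M (Suc (Suc k))"
    using M unfolding LC_def by (auto dest: spec[of _ "Suc k"])
  then show ?thesis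
    using LC_pos by (simp add: Suc quot_def field_simps power2_eq_square)
qed (use LC_0 LC_1 in \<open>simp add: quot_def\<close>)

lemma quot_mono: "m \<le> n \<Longrightarrow> quot M m \<le> quot M n"
  using quot_Suc_mono by (rule lift_Suc_mono_le)

lemma quot_ge_1: "1 \<le> quot M p"
  using quot_mono[of 0 p] by (simp add: quot_def)

lemma ln_LC_Suc: "ln (M (Suc p)) = ln (M p) + ln (quot M (Suc p))"
  using LC_pos by (simp add: quot_def ln_div LC_nonzero)

lemma ln_quot_mono: "m \<le> n \<Longrightarrow> ln (quot M m) \<le> ln (quot M n)"
  using quot_mono quot_pos by simp

lemma ln_quot_nonneg: "0 \<le> ln (quot M p)"
  using quot_ge_1 by simp

text \<open>The increments of \<open>ln M\<close> increase, so the line through \<open>n\<close>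
  with the left slope \<open>ln (quot M n)\<close> supports \<open>ln M\<close> from below on both
  sides of \<open>n\<close>.\<close>

lemma ln_LC_subgradient: "ln (M n) + (real p - real n) * ln (quot M n) \<le> ln (M p)"
proof (cases "n \<le> p")
  case True
  then show ?thesis
  proof (induction p rule: dec_induct)
    case (step p)
    then show ?case
      using ln_LC_Suc[of p] ln_quot_mono[of n "Suc p"] by (simp add: algebra_simps)
  qed simp
next
  case False
  then have "p \<le> n" by simp
  then show ?thesis
  proof (induction p rule: inc_induct)
    case (step p)
    then show ?case
      using ln_LC_Suc[of p] ln_quot_mono[of "Suc p" n] by (simp add: algebra_simps)
  qed simp
qed

lemma ln_LC_nonneg: "0 \<le> ln (M p)"
  using ln_LC_subgradient[of 0 p] by (simp add: LC_0 quot_def)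

text \<open>The root condition of \<open>LC\<close> in logarithmic form; it is what keeps the
  supremum in the associated weight finite.\<close>

lemma ln_LC_superlinear: "eventually (\<lambda>p. real p * y \<le> ln (M p)) sequentially"
proof -
  have "filterlim (\<lambda>p. M p powr (1 / real p)) at_top sequentially"
    using M by (simp add: LC_def)
  then have "eventually (\<lambda>p. exp y \<le> M p powr (1 / real p)) sequentially"
    by (simp add: filterlim_at_top)
  then show ?thesis
    using eventually_gt_at_top[of 0]
  proof eventually_elim
    case (elim p)
    then show ?case
      using LC_pos[of p] by (simp add: powr_def field_simps)
  qed
qed

lemma bdd_above_affine: "bdd_above (range (\<lambda>p. real p * y - ln (M p)))"
proof -
  obtain n where n: "\<And>p. p \<ge> n \<Longrightarrow> real p * y \<le> ln (M p)"
    using ln_LC_superlinear[of y] by (auto simp: eventually_sequentially)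
  obtain B where B: "B \<ge> 0" "\<And>p. p \<le> n \<Longrightarrow> real p * y - ln (M p) \<le> B"
    using finite_bounds_above[of n "\<lambda>p. real p * y - ln (M p)"] by blast
  show ?thesis
  proof (rule bdd_aboveI2)
    show "real p * y - ln (M p) \<le> B" for p
      using n[of p] B(2)[of p] B(1) by (cases "p \<le> n") auto
  qed
qed

section \<open>The associated weight function and its Young conjugate\<close>

lemma assoc_weight_eq: "t > 0 \<Longrightarrow> assoc_weight M t = (SUP p. real p * ln t - ln (M p))"
  using LC_pos by (simp add: assoc_weight_def ln_div ln_realpow LC_nonzero)

lemma assoc_weight_upper: "t > 0 \<Longrightarrow> real p * ln t - ln (M p) \<le> assoc_weight M t"
  by (simp add: assoc_weight_eq cSUP_upper[OF UNIV_I bdd_above_affine])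

lemma assoc_weight_least:
  "t > 0 \<Longrightarrow> (\<And>p. real p * ln t - ln (M p) \<le> B) \<Longrightarrow> assoc_weight M t \<le> B"
  by (simp add: assoc_weight_eq cSUP_least)

lemma assoc_weight_nonneg: "0 \<le> assoc_weight M t"
  using assoc_weight_upper[of t 0] by (cases "t > 0") (auto simp: LC_0 assoc_weight_def)

text \<open>Testing the supremum in the weight with the single index \<open>p\<close> suffices. This
  gives finiteness of the conjugate and one half of its value at naturals.\<close>

lemma young_conj_bounded:
  assumes "x \<le> real p" "y \<ge> 0"
  shows "x * y - assoc_weight M (exp y) \<le> ln (M p)"
  using assoc_weight_upper[of "exp y" p] mult_right_mono[OF assms] by simp

abbreviation (input) conj_weight :: "real \<Rightarrow> real" where
  "conj_weight \<equiv> young_conj (\<lambda>y. assoc_weight M (exp y))"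

lemma bdd_above_young_conj: "bdd_above ((\<lambda>y. x * y - assoc_weight M (exp y)) ` {0..})"
  using young_conj_bounded[of x "nat \<lceil>x\<rceil>"]
  by (auto intro!: bdd_aboveI2 simp: real_nat_ceiling_ge)

lemma convex_conj_weight: "convex_on UNIV conj_weight"
  unfolding young_conj_def
proof (rule convex_on_SUP)
  show "convex_on UNIV (\<lambda>x. x * y - assoc_weight M (exp y))" for y
    by (intro convex_onI) (auto simp: algebra_simps)
qed (use bdd_above_young_conj in auto)

text \<open>Biconjugation returns \<open>ln M\<close> at the naturals because \<open>ln M\<close>
  has a supporting line at each of them.\<close>

lemma conj_weight_of_nat: "conj_weight (real n) = ln (M n)"
proof (rule antisym)
  show "conj_weight (real n) \<le> ln (M n)"
    unfolding young_conj_def by (rule cSUP_least) (auto intro: young_conj_bounded)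
  \<comment> \<open>The maximiser is \<open>y = ln (quot M n)\<close>: there the supremum in the
    weight is attained at \<open>p = n\<close>. It is admissible since the quotients are at least
    1.\<close>
  have "assoc_weight M (exp (ln (quot M n))) \<le> real n * ln (quot M n) - ln (M n)"
  proof (rule assoc_weight_least)
    show "real p * ln (exp (ln (quot M n))) - ln (M p) \<le> real n * ln (quot M n) - ln (M n)" for p
      using ln_LC_subgradient[of n p] by (simp add: algebra_simps)
  qed simp
  moreover have "real n * ln (quot M n) - assoc_weight M (exp (ln (quot M n))) \<le> conj_weight (real n)"
    unfolding young_conj_def by (rule cSUP_upper[OF _ bdd_above_young_conj]) (simp add: ln_quot_nonneg)
  ultimately show "ln (M n) \<le> conj_weight (real n)" by simp
qed

lemma conj_weight_0: "conj_weight 0 = 0"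
  using conj_weight_of_nat[of 0] by (simp add: LC_0)

text \<open>As the conjugate vanishes at 0, this is the slope of its chord from the origin; at
  \<open>l * p\<close> it is the logarithm of the \<open>p\<close>-th root of
  \<open>M^(l)_p\<close>.\<close>

definition mean_slope :: "real \<Rightarrow> real" where
  "mean_slope s = conj_weight s / s"

lemma mean_slope_mono: "0 < s \<Longrightarrow> s \<le> t \<Longrightarrow> mean_slope s \<le> mean_slope t"
  using convex_on_slope_mono[OF convex_conj_weight, of 0 s 0 t]
  by (simp add: mean_slope_def conj_weight_0)

lemma mean_slope_of_nat: "mean_slope (real n) = ln (M n) / real n"
  by (simp add: mean_slope_def conj_weight_of_nat)

lemma mean_slope_nonneg:
  assumes "0 < s"
  shows "0 \<le> mean_slope s"
proof -
  \<comment> \<open>The competitor \<open>y = 0\<close> in the conjugate shows that it is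
    nonnegative.\<close>
  have "assoc_weight M (exp 0) \<le> 0"
    by (rule assoc_weight_least) (use ln_LC_nonneg in auto)
  moreover have "s * 0 - assoc_weight M (exp 0) \<le> conj_weight s"
    unfolding young_conj_def by (rule cSUP_upper[OF _ bdd_above_young_conj]) simp
  ultimately show ?thesis using assms by (simp add: mean_slope_def)
qed

section \<open>Quotients and roots of the matrix members as slopes\<close>

abbreviation (input) assoc_matrix :: "real \<Rightarrow> nat \<Rightarrow> real" where
  "assoc_matrix \<equiv> weight_matrix (assoc_weight M)"

lemma assoc_matrix_1: "assoc_matrix 1 = M"
  using LC_pos by (auto simp: weight_matrix_def conj_weight_of_nat)

lemma assoc_matrix_pos: "assoc_matrix l p > 0"
  by (simp add: weight_matrix_def)

lemma quot_assoc_matrix_pos: "quot (assoc_matrix l) p > 0"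
  by (simp add: quot_def assoc_matrix_pos)

lemma root_assoc_matrix:
  assumes "l > 0" "p > 0"
  shows "assoc_matrix l p powr (1 / real p) = exp (mean_slope (l * real p))"
  using assms by (simp add: weight_matrix_def mean_slope_def powr_def)

lemma root_LC: "n > 0 \<Longrightarrow> M n powr (1 / real n) = exp (mean_slope (real n))"
  using root_assoc_matrix[of 1 n] by (simp add: assoc_matrix_1)

text \<open>The denominator equals \<open>l\<close>; it stays a difference to match the shape of
  \<open>convex_on_slope_mono\<close>.\<close>

lemma quot_assoc_matrix_Suc:
  assumes "l > 0"
  shows "quot (assoc_matrix l) (Suc p) =
    exp ((conj_weight (l * real (Suc p)) - conj_weight (l * real p)) / (l * real (Suc p) - l * real p))"
proof -
  have "l * real (Suc p) - l * real p = l" by (simp add: algebra_simps)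
  then show ?thesis
    by (simp only:) (simp add: quot_def weight_matrix_def diff_divide_distrib exp_diff)
qed

lemma ln_quot_eq_slope:
  "ln (quot M (Suc n)) = (conj_weight (real (Suc n)) - conj_weight (real n)) / (real (Suc n) - real n)"
  by (simp only: conj_weight_of_nat ln_LC_Suc) simp

text \<open>The interval \<open>[l * (p - 1), l * p]\<close> lies to the left of
  \<open>[n, n + 1]\<close>, and slopes increase.\<close>

lemma quot_assoc_matrix_le:
  assumes "l > 0" "p > 0" "l * real p \<le> real n"
  shows "quot (assoc_matrix l) p \<le> quot M (Suc n)"
proof -
  obtain k where k: "p = Suc k" using assms by (cases p) auto
  have "(conj_weight (l * real (Suc k)) - conj_weight (l * real k)) / (l * real (Suc k) - l * real k)
    \<le> (conj_weight (real (Suc n)) - conj_weight (real n)) / (real (Suc n) - real n)"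
    using assms unfolding k
    by (intro convex_on_slope_mono[OF convex_conj_weight]) (auto simp: algebra_simps)
  then have "ln (quot (assoc_matrix l) p) \<le> ln (quot M (Suc n))"
    using assms by (simp only: ln_quot_eq_slope k quot_assoc_matrix_Suc ln_exp)
  then show ?thesis
    using quot_pos quot_assoc_matrix_pos by simp
qed

text \<open>Here \<open>[q - 1, q]\<close> lies to the left of
  \<open>[l * k, l * (k + 1)]\<close>.\<close>

lemma quot_le_quot_assoc_matrix:
  assumes "l > 0" "q > 0" "real q \<le> l * real k"
  shows "quot M q \<le> quot (assoc_matrix l) (Suc k)"
proof -
  obtain n where n: "q = Suc n" using assms by (cases q) auto
  have "(conj_weight (real (Suc n)) - conj_weight (real n)) / (real (Suc n) - real n)
    \<le> (conj_weight (l * real (Suc k)) - conj_weight (l * real k)) / (l * real (Suc k) - l * real k)"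
    using assms unfolding n
    by (intro convex_on_slope_mono[OF convex_conj_weight]) (auto simp: algebra_simps)
  then have "ln (quot M q) \<le> ln (quot (assoc_matrix l) (Suc k))"
    using assms by (simp only: ln_quot_eq_slope n quot_assoc_matrix_Suc ln_exp)
  then show ?thesis
    using quot_pos quot_assoc_matrix_pos by simp
qed

section \<open>Equivalence of the quotient/root comparison conditions\<close>

lemma quot_root_cond_iff:
  "quot_root_cond M \<longleftrightarrow>
    (\<exists>d>0. \<exists>A\<ge>1. \<forall>p>0. quot M p \<le> A * exp (mean_slope (real (d * p))))"
  unfolding quot_root_cond_def by (intro ex_cong1 conj_cong refl all_cong1 imp_cong)
    (simp add: root_LC del: of_nat_mult)

lemma quot_root_Roumieu_iff:
  "quot_root_Roumieu assoc_matrix \<longleftrightarrow>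
    (\<forall>x>0. \<exists>y>0. \<exists>A\<ge>1. \<forall>p>0. quot (assoc_matrix x) p \<le> A * exp (mean_slope (y * real p)))"
  unfolding quot_root_Roumieu_def
  by (intro all_cong1 imp_cong ex_cong1 conj_cong refl) (simp add: root_assoc_matrix)

lemma quot_root_Beurling_iff:
  "quot_root_Beurling assoc_matrix \<longleftrightarrow>
    (\<forall>x>0. \<exists>y>0. \<exists>A\<ge>1. \<forall>p>0. quot (assoc_matrix y) p \<le> A * exp (mean_slope (x * real p)))"
  unfolding quot_root_Beurling_def
  by (intro all_cong1 imp_cong ex_cong1 conj_cong refl) (simp add: root_assoc_matrix)

lemma scaled_exp_mean_slope_mono:
  assumes "A \<ge> 1" "0 < s" "s \<le> t"
  shows "A * exp (mean_slope s) \<le> A * exp (mean_slope t)"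
  using assms mean_slope_mono[of s t] by (intro mult_left_mono) auto

lemma quot_root_cond_imp_Roumieu:
  assumes "quot_root_cond M"
  shows "quot_root_Roumieu assoc_matrix"
  unfolding quot_root_Roumieu_iff
proof (intro allI impI)
  fix x :: real assume x: "x > 0"
  obtain d A where d: "d > 0" and A: "A \<ge> 1"
    and dA: "\<And>p. p > 0 \<Longrightarrow> quot M p \<le> A * exp (mean_slope (real (d * p)))"
    using assms unfolding quot_root_cond_iff by blast
  have "quot (assoc_matrix x) p \<le> A * exp (mean_slope (real d * (x + 2) * real p))" if p: "p > 0" for p
  proof -
    define n where "n = nat \<lceil>x * real p\<rceil>"
    have n: "x * real p \<le> real n" "real n \<le> x * real p + 1"
      using nat_ceiling_bounds[of "x * real p"] x p by (simp_all add: n_def)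
    \<comment> \<open>Rounding \<open>x * p\<close> up and passing to the successor each cost at
      most 1; since \<open>p \<ge> 1\<close>, the summand 2 in \<open>x + 2\<close> absorbs
      both.\<close>
    have "real d * real (Suc n) \<le> real d * ((x + 2) * real p)"
      using n p by (intro mult_left_mono) (auto simp: algebra_simps)
    then have le: "real (d * Suc n) \<le> real d * (x + 2) * real p"
      by (simp only: of_nat_mult mult.assoc)
    have "quot (assoc_matrix x) p \<le> quot M (Suc n)"
      using quot_assoc_matrix_le x p n(1) .
    also have "\<dots> \<le> A * exp (mean_slope (real (d * Suc n)))"
      by (rule dA) simp
    also have "\<dots> \<le> A * exp (mean_slope (real d * (x + 2) * real p))"
      by (rule scaled_exp_mean_slope_mono[OF A _ le]) (use d in \<open>simp add: add_pos_nonneg\<close>)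
    finally show ?thesis .
  qed
  then show "\<exists>y>0. \<exists>A\<ge>1. \<forall>p>0. quot (assoc_matrix x) p \<le> A * exp (mean_slope (y * real p))"
    using d A x by (intro exI[of _ "real d * (x + 2)"] conjI exI[of _ A]) auto
qed

text \<open>The condition at index 1, whose member is \<open>M\<close> itself, gives the claim with
  \<open>d\<close> the ceiling of \<open>y\<close>, as mean slopes increase.\<close>

lemma Roumieu_imp_quot_root_cond:
  assumes "quot_root_Roumieu assoc_matrix"
  shows "quot_root_cond M"
  unfolding quot_root_cond_iff
proof -
  obtain y A where y: "y > 0" and A: "A \<ge> 1"
    and yA: "\<And>p. p > 0 \<Longrightarrow> quot M p \<le> A * exp (mean_slope (y * real p))"
    using assms[unfolded quot_root_Roumieu_iff, rule_format, of 1] by (auto simp: assoc_matrix_1)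
  have "quot M p \<le> A * exp (mean_slope (real (nat \<lceil>y\<rceil> * p)))" if p: "p > 0" for p
  proof -
    have le: "y * real p \<le> real (nat \<lceil>y\<rceil> * p)"
      using real_nat_ceiling_ge[of y] by (simp add: mult_right_mono)
    show ?thesis
      by (rule order_trans[OF yA[OF p] scaled_exp_mean_slope_mono[OF A _ le]]) (use y p in simp)
  qed
  then show "\<exists>d>0. \<exists>A\<ge>1. \<forall>p>0. quot M p \<le> A * exp (mean_slope (real (d * p)))"
    using y A by (intro exI[of _ "nat \<lceil>y\<rceil>"] conjI exI[of _ A]) auto
qed

lemma quot_root_cond_imp_Beurling:
  assumes "quot_root_cond M"
  shows "quot_root_Beurling assoc_matrix"
  unfolding quot_root_Beurling_iff
proof (intro allI impI)
  fix x :: real assume x: "x > 0"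
  obtain d A where d: "d > 0" and A: "A \<ge> 1"
    and dA: "\<And>p. p > 0 \<Longrightarrow> quot M p \<le> A * exp (mean_slope (real (d * p)))"
    using assms unfolding quot_root_cond_iff by blast
  \<comment> \<open>With this \<open>y\<close>, only half of \<open>x * p\<close> is used up; the
    other half absorbs the rounding error \<open>2 * d\<close> once
    \<open>x * p \<ge> 4 * d\<close>. The finitely many smaller \<open>p\<close> go into the
    constant \<open>B\<close>.\<close>
  define y where "y = x / (2 * real d)"
  have y: "y > 0" using x d by (simp add: y_def)
  obtain B where B: "B \<ge> 0" "\<And>p. p \<le> nat \<lceil>4 * real d / x\<rceil> \<Longrightarrow> quot (assoc_matrix y) p \<le> B"
    using finite_bounds_above[of "nat \<lceil>4 * real d / x\<rceil>" "quot (assoc_matrix y)"] by blast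
  have "quot (assoc_matrix y) p \<le> max A B * exp (mean_slope (x * real p))" if p: "p > 0" for p
  proof (cases "p \<le> nat \<lceil>4 * real d / x\<rceil>")
    case True
    have "B * 1 \<le> max A B * exp (mean_slope (x * real p))"
      using mean_slope_nonneg[of "x * real p"] x p A B by (intro mult_mono) auto
    then show ?thesis using B(2)[OF True] by simp
  next
    case False
    define n where "n = nat \<lceil>y * real p\<rceil>"
    have n: "y * real p \<le> real n" "real n \<le> y * real p + 1"
      using nat_ceiling_bounds[of "y * real p"] y p by (simp_all add: n_def)
    have "4 * real d / x \<le> real p"
      using False real_nat_ceiling_ge[of "4 * real d / x"] by linarith
    then have px: "4 * real d \<le> x * real p"
      using x by (simp add: field_simps)
    have "real d * real (Suc n) \<le> real d * (y * real p + 2)"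
      using n by (intro mult_left_mono) auto
    also have "\<dots> = x * real p / 2 + 2 * real d"
      using d by (simp add: y_def field_simps)
    finally have le: "real (d * Suc n) \<le> x * real p"
      using px by (simp only: of_nat_mult)
    have "quot (assoc_matrix y) p \<le> quot M (Suc n)"
      using quot_assoc_matrix_le y p n(1) .
    also have "\<dots> \<le> A * exp (mean_slope (real (d * Suc n)))"
      by (rule dA) simp
    also have "\<dots> \<le> A * exp (mean_slope (x * real p))"
      by (rule scaled_exp_mean_slope_mono[OF A _ le]) (use d in \<open>simp add: add_pos_nonneg\<close>)
    also have "\<dots> \<le> max A B * exp (mean_slope (x * real p))"
      by (intro mult_right_mono) auto
    finally show ?thesis .
  qed
  then show "\<exists>y>0. \<exists>A\<ge>1. \<forall>p>0. quot (assoc_matrix y) p \<le> A * exp (mean_slope (x * real p))"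
    using y A by (intro exI[of _ y] conjI exI[of _ "max A B"]) auto
qed

lemma Beurling_imp_quot_root_cond:
  assumes "quot_root_Beurling assoc_matrix"
  shows "quot_root_cond M"
  unfolding quot_root_cond_iff
proof -
  obtain y A where y: "y > 0" and A: "A \<ge> 1"
    and yA: "\<And>p. p > 0 \<Longrightarrow> quot (assoc_matrix y) p \<le> A * exp (mean_slope (real p))"
    using assms[unfolded quot_root_Beurling_iff, rule_format, of 1] by auto
  \<comment> \<open>The index \<open>k\<close> is \<open>q / y\<close> rounded up, so
    \<open>k + 1 \<le> q / y + 2\<close>, which is at most \<open>(1 / y + 2) * q\<close>.\<close>
  define d where "d = nat \<lceil>1 / y\<rceil> + 2"
  have "quot M q \<le> A * exp (mean_slope (real (d * q)))" if q: "q > 0" for q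
  proof -
    define k where "k = nat \<lceil>real q / y\<rceil>"
    have k: "real q / y \<le> real k" "real k \<le> real q / y + 1"
      using nat_ceiling_bounds[of "real q / y"] y q by (simp_all add: k_def)
    have "real (Suc k) \<le> (1 / y + 2) * real q"
      using k(2) q by (simp add: algebra_simps)
    also have "\<dots> \<le> real d * real q"
      using real_nat_ceiling_ge[of "1 / y"] by (intro mult_right_mono) (auto simp: d_def)
    finally have le: "real (Suc k) \<le> real (d * q)" by simp
    have "quot M q \<le> quot (assoc_matrix y) (Suc k)"
      using k(1) y q by (intro quot_le_quot_assoc_matrix) (auto simp: field_simps)
    also have "\<dots> \<le> A * exp (mean_slope (real (Suc k)))"
      by (rule yA) simp
    also have "\<dots> \<le> A * exp (mean_slope (real (d * q)))"
      by (rule scaled_exp_mean_slope_mono[OF A _ le]) simp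
    finally show ?thesis .
  qed
  then show "\<exists>d>0. \<exists>A\<ge>1. \<forall>p>0. quot M p \<le> A * exp (mean_slope (real (d * p)))"
    using A by (intro exI[of _ d] conjI exI[of _ A]) (auto simp: d_def)
qed

section \<open>Moderate growth and constancy of the matrix\<close>

lemma moderate_growth_ln:
  assumes "moderate_growth M"
  obtains c where "c \<ge> 0" "\<And>p q. ln (M (p + q)) \<le> c * real (p + q) + ln (M p) + ln (M q)"
proof -
  obtain C where C: "C \<ge> 1" "\<And>p q. M (p + q) \<le> C ^ (p + q) * M p * M q"
    using assms unfolding moderate_growth_def by blast
  show ?thesis
  proof (rule that[of "ln C"])
    fix p q
    have "ln (M (p + q)) \<le> ln (C ^ (p + q) * M p * M q)"
      using C(2)[of p q] LC_pos ln_mono by blast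
    also have "\<dots> = ln C * real (p + q) + ln (M p) + ln (M q)"
      using C(1) LC_pos LC_nonzero
      by (simp add: ln_mult ln_realpow power_add algebra_simps)
    finally show "ln (M (p + q)) \<le> \<dots>" .
  qed (use C in simp)
qed

text \<open>The supporting line at \<open>p\<close>, evaluated at \<open>2 * p\<close>, bounds
  \<open>p * ln (quot M p)\<close> by \<open>ln (M (2 * p)) - ln (M p)\<close>; moderate growth with
  \<open>q = p\<close> then gives the condition with \<open>d = 1\<close>.\<close>

lemma moderate_growth_imp_quot_root_cond:
  assumes "moderate_growth M"
  shows "quot_root_cond M"
proof -
  obtain c where c: "c \<ge> 0" "\<And>p q. ln (M (p + q)) \<le> c * real (p + q) + ln (M p) + ln (M q)"
    using moderate_growth_ln[OF assms] by blast
  have "quot M p \<le> exp (2 * c) * exp (mean_slope (real (1 * p)))" if p: "p > 0" for p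
  proof -
    have "real p * ln (quot M p) \<le> real p * (2 * c) + ln (M p)"
      using ln_LC_subgradient[of p "p + p"] c(2)[of p p] by (simp add: algebra_simps)
    also have "\<dots> = real p * (2 * c + mean_slope (real (1 * p)))"
      using p by (simp add: mean_slope_of_nat algebra_simps)
    finally have "ln (quot M p) \<le> 2 * c + mean_slope (real (1 * p))"
      using p by simp
    then have "exp (ln (quot M p)) \<le> exp (2 * c + mean_slope (real (1 * p)))"
      by (simp only: exp_le_cancel_iff)
    then show ?thesis using quot_pos by (simp add: exp_add)
  qed
  then show ?thesis
    unfolding quot_root_cond_iff using c(1)
    by (intro exI[of _ 1] conjI exI[of _ "exp (2 * c)"]) auto
qed

text \<open>At integers this is moderate growth with \<open>p = q\<close>; monotonicity of mean
  slopes extends it to real arguments at the price of a larger constant.\<close>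

lemma moderate_growth_mean_slope_double:
  assumes "moderate_growth M"
  obtains c where "c \<ge> 0" "\<And>s. s > 0 \<Longrightarrow> mean_slope (2 * s) \<le> mean_slope s + c"
proof -
  obtain c where c: "c \<ge> 0" "\<And>p q. ln (M (p + q)) \<le> c * real (p + q) + ln (M p) + ln (M q)"
    using moderate_growth_ln[OF assms] by blast
  have double: "mean_slope (real (2 * n)) \<le> mean_slope (real n) + c" if "n > 0" for n
  proof -
    have "ln (M (2 * n)) \<le> c * (2 * real n) + 2 * ln (M n)"
      using c(2)[of n n] by (simp flip: mult_2)
    also have "\<dots> = (ln (M n) / real n + c) * real (2 * n)"
      using that by (simp add: field_simps)
    finally show ?thesis
      using that unfolding mean_slope_of_nat by (subst pos_divide_le_eq) auto
  qed
  show ?thesis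
  proof (rule that[of "2 * c + mean_slope 2"])
    fix s :: real assume s: "s > 0"
    show "mean_slope (2 * s) \<le> mean_slope s + (2 * c + mean_slope 2)"
    proof (cases "s \<le> 1")
      case True
      then show ?thesis
        using mean_slope_mono[of "2 * s" 2] mean_slope_nonneg[of s] s c(1) by simp
    next
      case False
      define n where "n = nat \<lfloor>s\<rfloor>"
      have n: "n > 0" "real n \<le> s" "s \<le> real n + 1"
        using False unfolding n_def by linarith+
      \<comment> \<open>Since \<open>s \<le> n + 1\<close> and \<open>n \<ge> 1\<close>, two integer
        doublings of \<open>n\<close> reach beyond \<open>2 * s\<close>.\<close>
      then have "mean_slope (2 * s) \<le> mean_slope (real (2 * (2 * n)))"
        using s by (intro mean_slope_mono) auto
      also have "\<dots> \<le> mean_slope (real n) + 2 * c"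
        using double[of "2 * n"] double[of n] n by simp
      also have "mean_slope (real n) \<le> mean_slope s"
        using n by (intro mean_slope_mono) auto
      finally show ?thesis
        using mean_slope_nonneg[of 2] by simp
    qed
  qed (use c mean_slope_nonneg[of 2] in simp)
qed

text \<open>Doubling is iterated \<open>k\<close> times, where \<open>2 ^ k\<close> dominates
  \<open>x / y\<close>.\<close>

lemma moderate_growth_mean_slope_dilate:
  assumes "moderate_growth M" "x > 0" "y > 0"
  obtains B where "\<And>s. s > 0 \<Longrightarrow> mean_slope (x * s) \<le> mean_slope (y * s) + B"
proof -
  obtain c where c: "c \<ge> 0" "\<And>s. s > 0 \<Longrightarrow> mean_slope (2 * s) \<le> mean_slope s + c"
    using moderate_growth_mean_slope_double[OF assms(1)] by blast
  obtain k where k: "x / y \<le> 2 ^ k"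
    using real_arch_pow[of 2 "x / y"] by (auto intro: less_imp_le)
  have pow: "mean_slope (2 ^ j * s) \<le> mean_slope s + real j * c" if "s > 0" for j s
  proof (induction j)
    case (Suc j)
    then show ?case
      using c(2)[of "2 ^ j * s"] that by (simp add: algebra_simps)
  qed simp
  show ?thesis
  proof (rule that[of "real k * c"])
    fix s :: real assume s: "s > 0"
    have "x * s \<le> 2 ^ k * (y * s)"
      using k s assms by (simp add: field_simps)
    then have "mean_slope (x * s) \<le> mean_slope (2 ^ k * (y * s))"
      using s assms by (intro mean_slope_mono) auto
    also have "\<dots> \<le> mean_slope (y * s) + real k * c"
      using s assms by (intro pow) auto
    finally show "mean_slope (x * s) \<le> \<dots>" .
  qed
qed

lemma root_quotient_assoc_matrix:
  assumes "x > 0" "y > 0" "p > 0"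
  shows "(assoc_matrix x p / assoc_matrix y p) powr (1 / real p) =
    exp (mean_slope (x * real p) - mean_slope (y * real p))"
  using assms assoc_matrix_pos[THEN less_imp_le]
  by (simp add: powr_divide root_assoc_matrix exp_diff)

lemma moderate_growth_imp_constant_matrix:
  assumes "moderate_growth M"
  shows "constant_matrix assoc_matrix"
proof -
  have "bdd_above ((\<lambda>p. (assoc_matrix x p / assoc_matrix y p) powr (1 / real p)) ` {1..})"
    if xy: "x > 0" "y > 0" for x y
  proof -
    obtain B where B: "\<And>s. s > 0 \<Longrightarrow> mean_slope (x * s) \<le> mean_slope (y * s) + B"
      using moderate_growth_mean_slope_dilate[OF assms xy] by blast
    show ?thesis
    proof (rule bdd_aboveI2)
      fix p :: nat assume "p \<in> {1..}"
      then have p: "p > 0" by simp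
      show "(assoc_matrix x p / assoc_matrix y p) powr (1 / real p) \<le> exp B"
        using B[of "real p"] p by (simp add: root_quotient_assoc_matrix xy)
    qed
  qed
  then show ?thesis
    unfolding constant_matrix_def seq_equiv_def by (intro allI impI conjI)
qed

text \<open>Comparing the members with indices \<open>1/2\<close> and \<open>1\<close> rather than \<open>1\<close> and \<open>2\<close> makes the
  midpoint \<open>(p + q) / 2\<close> available also when \<open>p + q\<close> is odd.\<close>

lemma constant_matrix_imp_moderate_growth:
  assumes "constant_matrix assoc_matrix"
  shows "moderate_growth M"
proof -
  have "seq_equiv (assoc_matrix (1/2)) (assoc_matrix 1)"
    using assms unfolding constant_matrix_def by simp
  then have "bdd_above ((\<lambda>p. (assoc_matrix 1 p / assoc_matrix (1/2) p) powr (1 / real p)) ` {1..})"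
    unfolding seq_equiv_def by (rule conjunct2)
  then obtain B where B: "\<And>p. p \<ge> 1 \<Longrightarrow> (assoc_matrix 1 p / assoc_matrix (1/2) p) powr (1 / real p) \<le> B"
    unfolding bdd_above_def by auto
  define c where "c = ln (max 1 B)"
  have half: "mean_slope (real n) \<le> mean_slope (real n / 2) + c" if n: "n > 0" for n
  proof -
    have "exp (mean_slope (1 * real n) - mean_slope (1/2 * real n)) \<le> B"
      using root_quotient_assoc_matrix[of 1 "1/2" n] B[of n] n by simp
    then have "exp (mean_slope (real n) - mean_slope (real n / 2)) \<le> max 1 B"
      by simp
    also have "\<dots> = exp c" by (simp add: c_def)
    finally show ?thesis by simp
  qed
  have "M (p + q) \<le> exp c ^ (p + q) * M p * M q" for p q
  proof (cases "p + q = 0")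
    case True
    then show ?thesis by (simp add: LC_0)
  next
    case False
    then have n: "p + q > 0" by simp
    have "ln (M (p + q)) = real (p + q) * mean_slope (real (p + q))"
      using n unfolding mean_slope_of_nat by (simp del: of_nat_add)
    also have "\<dots> \<le> real (p + q) * (mean_slope (real (p + q) / 2) + c)"
      using half[OF n] by (intro mult_left_mono) auto
    also have "\<dots> = 2 * conj_weight (real (p + q) / 2) + real (p + q) * c"
      using n unfolding mean_slope_def distrib_left by (simp del: of_nat_add)
    \<comment> \<open>Convexity at the midpoint of \<open>p\<close> and \<open>q\<close> splits the
      joint term.\<close>
    also have "2 * conj_weight (real (p + q) / 2) \<le> conj_weight (real p) + conj_weight (real q)"
      using convex_onD[OF convex_conj_weight, of "1/2" "real p" "real q"] by (simp add: field_simps)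
    finally have "ln (M (p + q)) \<le> real (p + q) * c + ln (M p) + ln (M q)"
      by (simp add: conj_weight_of_nat)
    then have "exp (ln (M (p + q))) \<le> exp (real (p + q) * c + ln (M p) + ln (M q))"
      by simp
    also have "\<dots> = exp c ^ (p + q) * M p * M q"
      using LC_pos by (simp add: exp_add exp_of_nat_mult del: of_nat_add)
    finally show ?thesis using LC_pos by simp
  qed
  then show ?thesis
    unfolding moderate_growth_def by (intro exI[of _ "exp c"]) (simp add: c_def)
qed

lemma quot_root_cond_iff_Roumieu: "quot_root_cond M \<longleftrightarrow> quot_root_Roumieu assoc_matrix"
  using quot_root_cond_imp_Roumieu Roumieu_imp_quot_root_cond by blast

lemma quot_root_cond_iff_Beurling: "quot_root_cond M \<longleftrightarrow> quot_root_Beurling assoc_matrix"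
  using quot_root_cond_imp_Beurling Beurling_imp_quot_root_cond by blast

lemma moderate_growth_iff_constant_matrix: "moderate_growth M \<longleftrightarrow> constant_matrix assoc_matrix"
  using moderate_growth_imp_constant_matrix constant_matrix_imp_moderate_growth by blast

section \<open>Regularity of the associated weight function\<close>

lemma assoc_weight_mono:
  assumes "0 \<le> s" "s \<le> t"
  shows "assoc_weight M s \<le> assoc_weight M t"
proof (cases "s = 0")
  case True
  then show ?thesis using assoc_weight_nonneg by (simp add: assoc_weight_def)
next
  case False
  then have s: "s > 0" "t > 0" using assms by auto
  have "real p * ln s - ln (M p) \<le> assoc_weight M t" for p
    using assoc_weight_upper[of t p] mult_left_mono[of "ln s" "ln t" "real p"] s assms by simp
  then show ?thesis using s by (intro assoc_weight_least)
qed

lemma assoc_weight_eq_0: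
  assumes "t \<le> 1"
  shows "assoc_weight M t = 0"
proof (cases "t > 0")
  case True
  have "real p * ln t - ln (M p) \<le> 0" for p
    using mult_nonneg_nonpos[of "real p" "ln t"] True assms ln_LC_nonneg[of p] by simp
  then have "assoc_weight M t \<le> 0" using True by (intro assoc_weight_least)
  then show ?thesis using assoc_weight_nonneg[of t] by simp
qed (simp add: assoc_weight_def)

lemma convex_assoc_weight_exp: "convex_on UNIV (\<lambda>y. assoc_weight M (exp y))"
proof -
  have "convex_on UNIV (\<lambda>y. SUP p. real p * y - ln (M p))"
  proof (rule convex_on_SUP)
    show "convex_on UNIV (\<lambda>y. real p * y - ln (M p))" for p
      by (intro convex_onI) (auto simp: algebra_simps)
  qed (auto intro: bdd_above_affine)
  then show ?thesis by (simp add: assoc_weight_eq)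
qed

text \<open>For \<open>t \<ge> 1\<close> the weight is a convex, hence continuous, function of
  \<open>ln t\<close>; on \<open>[0, 1]\<close> it vanishes, and the two pieces meet at 1.\<close>

lemma continuous_on_assoc_weight: "continuous_on {0..} (assoc_weight M)"
proof -
  have "continuous_on {1..} (\<lambda>t. assoc_weight M (exp (ln t)))"
    by (rule continuous_on_compose2[OF convex_on_continuous[OF open_UNIV convex_assoc_weight_exp]])
      (auto intro!: continuous_intros)
  then have "continuous_on {1..} (assoc_weight M)"
    by (rule continuous_on_eq) simp
  moreover have "continuous_on {0..1} (assoc_weight M)"
    by (rule continuous_on_eq[of _ "\<lambda>_. 0"]) (simp_all add: assoc_weight_eq_0)
  ultimately have "continuous_on ({0..1} \<union> {1..}) (assoc_weight M)"
    by (intro continuous_on_closed_Un) auto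
  moreover have "{0..1} \<union> {1..} = {0::real..}" by auto
  ultimately show ?thesis by simp
qed

lemma filterlim_assoc_weight: "filterlim (assoc_weight M) at_top at_top"
proof (rule filterlim_at_top_mono)
  show "filterlim (\<lambda>t. - ln (M 1) + ln t) at_top at_top"
    by (rule filterlim_tendsto_add_at_top[OF tendsto_const ln_at_top])
  show "eventually (\<lambda>t. - ln (M 1) + ln t \<le> assoc_weight M t) at_top"
    using eventually_gt_at_top[of 0] by eventually_elim (use assoc_weight_upper[of _ 1] in simp)
qed

lemma weight_function_assoc_weight: "weight_function (assoc_weight M)"
  unfolding weight_function_def
  using continuous_on_assoc_weight filterlim_assoc_weight assoc_weight_eq_0
  by (auto intro!: mono_onI assoc_weight_mono)

section \<open>From strong non-quasianalyticity to a strong weight\<close>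

lemma sum_ln_quot: "(\<Sum>j=1..n. ln (quot M j)) = ln (M n)"
  by (induction n) (simp_all add: LC_0 ln_LC_Suc)

text \<open>Quotients increase, so the positive terms form an initial segment \<open>{1..k}\<close>;
  their sum is the competitor of index \<open>k\<close> in the weight.\<close>

lemma sum_positive_part_le_assoc_weight:
  assumes "t > 0"
  shows "(\<Sum>j=1..n. max 0 (ln t - ln (quot M j))) \<le> assoc_weight M t"
proof -
  have "\<exists>k. (\<Sum>j=1..n. max 0 (ln t - ln (quot M j))) = real k * ln t - ln (M k)"
  proof (induction n)
    case 0
    show ?case by (rule exI[of _ 0]) (simp add: LC_0)
  next
    case (Suc n)
    show ?case
    proof (cases "ln (quot M (Suc n)) \<le> ln t")
      case True
      have "(\<Sum>j=1..Suc n. max 0 (ln t - ln (quot M j))) = (\<Sum>j=1..Suc n. ln t - ln (quot M j))"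
      proof (intro sum.cong refl max_absorb2)
        show "0 \<le> ln t - ln (quot M j)" if "j \<in> {1..Suc n}" for j
          using that True ln_quot_mono[of j "Suc n"] by simp
      qed
      also have "\<dots> = real (Suc n) * ln t - ln (M (Suc n))"
        by (simp only: sum_subtractf sum_ln_quot) simp
      finally show ?thesis by blast
    next
      case False
      then show ?thesis using Suc.IH by simp
    qed
  qed
  then show ?thesis using assoc_weight_upper[OF assms] by metis
qed

text \<open>Since \<open>\<omega>(t) = \<Sum>\<^sub>j max 0 (ln (t / \<mu>\<^sub>j))\<close>, summing over blocks of \<open>Q\<close> consecutive
  indices turns the growth of the quotients into a growth bound for \<open>\<omega>\<close>.\<close>

lemma assoc_weight_dilate_log:
  assumes K: "K > 1" and Q: "Q > 0" and m0: "m0 > 0"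
    and growth: "\<And>m. m \<ge> m0 \<Longrightarrow> K * quot M m \<le> quot M (Q * m)" and t: "t > 0"
  shows "assoc_weight M (K * t) \<le>
    real Q * assoc_weight M t + real (Q * m0) * max 0 (ln (K * t))"
proof (rule assoc_weight_least)
  show "K * t > 0" using K t by simp
next
  fix p
  define f where "f s j = max 0 (ln s - ln (quot M j))" for s j
  define c where "c = max 0 (ln (K * t))"
  have f_nonneg: "f s j \<ge> 0" for s j by (simp add: f_def)
  \<comment> \<open>From \<open>m0\<close> on, quotients in the block of \<open>m\<close> are at
    least \<open>K * quot M m\<close>, which cancels the dilation by \<open>K\<close>. Earlier
    blocks get the crude bound \<open>c\<close>, valid because quotients are at least 1.\<close>
  have f_le: "f (K * t) j \<le> (if m < m0 then c else f t m)" if "m * Q \<le> j" for j m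
  proof (cases "m < m0")
    case True
    then show ?thesis using ln_quot_nonneg[of j] by (auto simp: f_def c_def)
  next
    case False
    then have "ln (K * quot M m) \<le> ln (quot M (Q * m))"
      using growth[of m] quot_pos K by (intro ln_mono) auto
    also have "\<dots> \<le> ln (quot M j)"
      using that by (intro ln_quot_mono) (simp add: mult.commute)
    finally show ?thesis
      using False K t quot_pos[of m] by (auto simp: f_def ln_mult)
  qed
  have "(\<Sum>m<Suc p. if m < m0 then c else f t m)
      = (\<Sum>m\<in>{..<Suc p} \<inter> {m. m < m0}. c) + (\<Sum>m\<in>{..<Suc p} \<inter> - {m. m < m0}. f t m)"
    by (rule sum.If_cases) simp
  \<comment> \<open>As \<open>m0 > 0\<close>, the index 0 belongs to the first sum and the second
    starts at 1.\<close>
  also have "\<dots> \<le> (\<Sum>m<m0. c) + (\<Sum>m=1..p. f t m)"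
    using m0 by (intro add_mono sum_mono2) (auto simp: f_nonneg c_def)
  also have "\<dots> \<le> real m0 * c + assoc_weight M t"
    using sum_positive_part_le_assoc_weight[OF t] by (simp add: f_def)
  finally have blocks: "(\<Sum>m<Suc p. if m < m0 then c else f t m) \<le> real m0 * c + assoc_weight M t" .
  have "real p * ln (K * t) - ln (M p) = (\<Sum>j=1..p. ln (K * t) - ln (quot M j))"
    by (simp only: sum_subtractf sum_ln_quot) simp
  also have "\<dots> \<le> (\<Sum>j=1..p. f (K * t) j)"
    by (intro sum_mono) (simp add: f_def)
  also have "\<dots> \<le> (\<Sum>j<Suc p * Q. f (K * t) j)"
  proof (intro sum_mono2)
    have "Suc p * 1 \<le> Suc p * Q" using Q by (intro mult_le_mono2) simp
    then show "{1..p} \<subseteq> {..<Suc p * Q}" by auto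
  qed (auto simp: f_nonneg)
  also have "\<dots> = (\<Sum>m<Suc p. \<Sum>j=m * Q..<m * Q + Q. f (K * t) j)"
    by (rule sum.nat_group[symmetric])
  also have "\<dots> \<le> (\<Sum>m<Suc p. \<Sum>j=m * Q..<m * Q + Q. if m < m0 then c else f t m)"
    by (intro sum_mono f_le) simp
  also have "\<dots> = real Q * (\<Sum>m<Suc p. if m < m0 then c else f t m)"
    by (simp only: sum_constant card_atLeastLessThan add_diff_cancel_left' sum_distrib_left)
  also have "\<dots> \<le> real Q * (real m0 * c + assoc_weight M t)"
    using blocks by (intro mult_left_mono) auto
  finally show "real p * ln (K * t) - ln (M p) \<le>
      real Q * assoc_weight M t + real (Q * m0) * max 0 (ln (K * t))"
    by (simp add: c_def algebra_simps)
qed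

text \<open>The block estimate has the factor \<open>Q < K\<close> but a logarithmic error. The
  weight outgrows every multiple of \<open>ln t\<close>, so a slightly larger factor, still below
  \<open>K\<close>, absorbs that error.\<close>

lemma strongly_nonquasianalytic_dilate:
  assumes "strongly_nonquasianalytic M"
  obtains K q D where "1 < q" "q < K" "0 \<le> D"
    "\<And>t. t > 0 \<Longrightarrow> assoc_weight M (K * t) \<le> q * assoc_weight M t + D"
proof -
  obtain Q where Q: "Q \<ge> 2" "liminf (\<lambda>p. ereal (quot M (Q * p) / quot M p)) > ereal (real Q)"
    using assms unfolding strongly_nonquasianalytic_def by blast
  obtain K where K: "real Q < K" "ereal K < liminf (\<lambda>p. ereal (quot M (Q * p) / quot M p))"
    using ereal_dense2[OF Q(2)] by auto
  have "eventually (\<lambda>p. ereal K < ereal (quot M (Q * p) / quot M p)) sequentially"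
    by (rule less_LiminfD[OF K(2)])
  then obtain m where m: "\<And>p. p \<ge> m \<Longrightarrow> K < quot M (Q * p) / quot M p"
    unfolding eventually_sequentially by auto
  define m0 where "m0 = Suc m"
  have growth: "K * quot M p \<le> quot M (Q * p)" if "p \<ge> m0" for p
    using m[of p] that quot_pos[of p] by (simp add: m0_def pos_less_divide_eq)
  \<comment> \<open>Half of the gap between \<open>Q\<close> and \<open>K\<close> is spent on the
    error.\<close>
  define e where "e = (K - real Q) / 2"
  have e: "e > 0" using K by (simp add: e_def)
  \<comment> \<open>The competitor of index \<open>n\<close> bounds \<open>n * ln t\<close> by the
    weight plus \<open>ln (M n)\<close>; this \<open>n\<close> makes \<open>e * n\<close> dominate
    the error coefficient \<open>Q * m0\<close>.\<close>
  define n where "n = nat \<lceil>real (Q * m0) / e\<rceil>"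
  have "real (Q * m0) / e \<le> real n"
    by (simp only: n_def real_nat_ceiling_ge)
  then have n: "real (Q * m0) \<le> e * real n"
    using e by (simp only: pos_divide_le_eq mult.commute)
  have K1: "K > 1" using K Q by simp
  show ?thesis
  proof (rule that[of "real Q + e" K "real (Q * m0) * ln K + e * ln (M n)"])
    show "1 < real Q + e" using Q e by simp
    show "real Q + e < K" using K by (simp add: e_def field_simps)
    show "0 \<le> real (Q * m0) * ln K + e * ln (M n)"
      using K1 e ln_LC_nonneg[of n] by simp
    fix t :: real assume t: "t > 0"
    have "real n * max 0 (ln t) \<le> assoc_weight M t + ln (M n)"
      using assoc_weight_upper[OF t, of n] assoc_weight_nonneg[of t] ln_LC_nonneg[of n]
      by (auto simp: max_def)
    then have "e * (real n * max 0 (ln t)) \<le> e * (assoc_weight M t + ln (M n))"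
      using e by (intro mult_left_mono) auto
    moreover have "real (Q * m0) * max 0 (ln t) \<le> e * real n * max 0 (ln t)"
      by (rule mult_right_mono[OF n]) simp
    ultimately have "real (Q * m0) * max 0 (ln t) \<le> e * (assoc_weight M t + ln (M n))"
      by (simp only: mult.assoc)
    moreover have "real (Q * m0) * max 0 (ln (K * t)) \<le> real (Q * m0) * (ln K + max 0 (ln t))"
      using K1 t by (intro mult_left_mono) (auto simp: ln_mult)
    moreover have "assoc_weight M (K * t) \<le> real Q * assoc_weight M t + real (Q * m0) * max 0 (ln (K * t))"
      by (rule assoc_weight_dilate_log[OF K1 _ _ growth t]) (use Q in \<open>auto simp: m0_def\<close>)
    ultimately show "assoc_weight M (K * t) \<le>
        (real Q + e) * assoc_weight M t + (real (Q * m0) * ln K + e * ln (M n))"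
      by (simp only: distrib_left distrib_right)
  qed
qed

lemma strongly_nonquasianalytic_power_bound:
  assumes "strongly_nonquasianalytic M"
  obtains \<alpha> A B where "0 < \<alpha>" "\<alpha> < 1" "0 \<le> A" "0 \<le> B"
    "\<And>y t. y > 0 \<Longrightarrow> t \<ge> 1 \<Longrightarrow> assoc_weight M (y * t) \<le> A * (assoc_weight M y + B) * t powr \<alpha>"
proof -
  obtain K q D where q: "1 < q" "q < K" and D: "0 \<le> D"
    and dil: "\<And>t. t > 0 \<Longrightarrow> assoc_weight M (K * t) \<le> q * assoc_weight M t + D"
    using strongly_nonquasianalytic_dilate[OF assms] by blast
  \<comment> \<open>Adding the solution \<open>B\<close> of \<open>D + B = q * B\<close> to the
    weight removes the additive constant, so the inequality iterates without remainder.\<close>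
  define B where "B = D / (q - 1)"
  have B: "B \<ge> 0" "D + B = q * B" using q D by (simp_all add: B_def field_simps)
  have iter: "assoc_weight M (K ^ n * y) + B \<le> q ^ n * (assoc_weight M y + B)" if y: "y > 0" for n y
  proof (induction n)
    case (Suc n)
    have "assoc_weight M (K ^ Suc n * y) + B \<le> q * (assoc_weight M (K ^ n * y) + B)"
      using dil[of "K ^ n * y"] B(2) q y by (simp add: mult.assoc distrib_left)
    also have "\<dots> \<le> q * (q ^ n * (assoc_weight M y + B))"
      using Suc.IH q by (intro mult_left_mono) auto
    finally show ?case by (simp add: mult.assoc)
  qed simp
  \<comment> \<open>This exponent satisfies \<open>q powr (log K t) = t powr \<alpha>\<close>; it is
    below 1 because \<open>q < K\<close>.\<close>
  define \<alpha> where "\<alpha> = ln q / ln K"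
  have \<alpha>: "0 < \<alpha>" "\<alpha> < 1" using q by (simp_all add: \<alpha>_def)
  show ?thesis
  proof (rule that[of \<alpha> q B])
    fix y t :: real assume y: "y > 0" and t: "t \<ge> 1"
    define n where "n = nat \<lceil>log K t\<rceil>"
    have "0 \<le> log K t" using q t by simp
    then have n: "log K t \<le> real n" "real n \<le> log K t + 1"
      using nat_ceiling_bounds by (auto simp: n_def)
    have "t = K powr (log K t)" using q t by simp
    also have "\<dots> \<le> K powr (real n)" using n q by (intro powr_mono) auto
    also have "\<dots> = K ^ n" using q by (simp add: powr_realpow)
    finally have tK: "t \<le> K ^ n" .
    have "q ^ n = q powr (real n)" using q by (simp add: powr_realpow)
    also have "\<dots> \<le> q powr (log K t + 1)" using n q by (intro powr_mono) auto
    also have "\<dots> = q * t powr \<alpha>"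
      using q t by (simp add: \<alpha>_def log_def powr_def distrib_left distrib_right exp_add mult_ac)
    finally have qn: "q ^ n \<le> q * t powr \<alpha>" .
    have "assoc_weight M (y * t) \<le> assoc_weight M (K ^ n * y)"
      using tK y t by (intro assoc_weight_mono) (auto simp: mult.commute)
    also have "\<dots> \<le> q ^ n * (assoc_weight M y + B)"
      using iter[OF y, of n] B by simp
    also have "\<dots> \<le> q * t powr \<alpha> * (assoc_weight M y + B)"
      using qn assoc_weight_nonneg[of y] B by (intro mult_right_mono) auto
    finally show "assoc_weight M (y * t) \<le> q * (assoc_weight M y + B) * t powr \<alpha>"
      by (simp add: mult_ac)
  qed (use \<alpha> q B in auto)
qed

lemma strong_weight_assoc_weight:
  assumes "strongly_nonquasianalytic M"
  shows "strong_weight (assoc_weight M)"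
proof -
  obtain \<alpha> A B where \<alpha>: "0 < \<alpha>" "\<alpha> < 1" and A: "0 \<le> A" and B: "0 \<le> B"
    and bound: "\<And>y t. y > 0 \<Longrightarrow> t \<ge> 1 \<Longrightarrow>
      assoc_weight M (y * t) \<le> A * (assoc_weight M y + B) * t powr \<alpha>"
    using strongly_nonquasianalytic_power_bound[OF assms] by blast
  define a where "a = A / (1 - \<alpha>)"
  have a: "a \<ge> 0" using A \<alpha> by (simp add: a_def)
  \<comment> \<open>\<open>C\<close> dominates the coefficient \<open>a\<close> of the weight, the
    constant term \<open>a * B\<close>, and 1.\<close>
  define C where "C = 1 + a + a * B"
  have "(\<integral>\<^sup>+t\<in>{1..}. ennreal (assoc_weight M (y * t) / t\<^sup>2) \<partial>lborel)
      \<le> ennreal (C * assoc_weight M y + C)" if y: "y \<ge> 0" for y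
  proof (cases "y = 0")
    case True
    \<comment> \<open>The power bound requires \<open>y > 0\<close>; at \<open>y = 0\<close> the
      integrand vanishes.\<close>
    then show ?thesis by (simp add: assoc_weight_eq_0)
  next
    case False
    then have y: "y > 0" using that by simp
    define c where "c = A * (assoc_weight M y + B)"
    have c: "c \<ge> 0" using A B assoc_weight_nonneg[of y] by (simp add: c_def)
    have "assoc_weight M (y * t) / t\<^sup>2 \<le> c * t powr (\<alpha> - 2)" if t: "t \<ge> 1" for t
    proof -
      have "assoc_weight M (y * t) / t\<^sup>2 \<le> c * t powr \<alpha> / t\<^sup>2"
        using bound[OF y t] by (intro divide_right_mono) (auto simp: c_def)
      also have "\<dots> = c * t powr (\<alpha> - 2)"
        using t by (simp add: powr_diff powr_numeral)
      finally show ?thesis .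
    qed
    then have "(\<integral>\<^sup>+t\<in>{1..}. ennreal (assoc_weight M (y * t) / t\<^sup>2) \<partial>lborel)
        \<le> (\<integral>\<^sup>+t\<in>{1..}. ennreal (c * t powr (\<alpha> - 2)) \<partial>lborel)"
      by (intro nn_integral_mono) (auto intro: ennreal_leI split: split_indicator)
    also have "\<dots> = ennreal (c / (1 - \<alpha>))"
      using c \<alpha>(2) by (rule nn_integral_powr_atLeast_1)
    also have "c / (1 - \<alpha>) = a * assoc_weight M y + a * B"
      by (simp add: a_def c_def distrib_left add_divide_distrib)
    also have "ennreal (a * assoc_weight M y + a * B) \<le> ennreal (C * assoc_weight M y + C)"
      using a B assoc_weight_nonneg[of y]
      by (intro ennreal_leI add_mono mult_right_mono) (auto simp: C_def)
    finally show ?thesis .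
  qed
  moreover have "C \<ge> 1" using a B by (simp add: C_def)
  ultimately show ?thesis
    unfolding strong_weight_def using weight_function_assoc_weight by blast
qed

end

section \<open>Sequences prescribed by their logarithmic quotients\<close>

definition exp_sum :: "(nat \<Rightarrow> real) \<Rightarrow> nat \<Rightarrow> real" where
  "exp_sum f p = exp (\<Sum>j=1..p. f j)"

lemma quot_exp_sum: "p > 0 \<Longrightarrow> quot (exp_sum f) p = exp (f p)"
  by (cases p) (auto simp: quot_def exp_sum_def exp_add)

lemma root_exp_sum: "exp_sum f n powr (1 / real n) = exp ((\<Sum>j=1..n. f j) / real n)"
  by (simp add: exp_sum_def powr_def)

text \<open>A Cesaro argument: for \<open>n \<ge> 2 * (m + 1)\<close> at least half of the terms
  exceed or equal \<open>2 * Z\<close>, and the others are nonnegative.\<close>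

lemma filterlim_mean_at_top:
  fixes f :: "nat \<Rightarrow> real"
  assumes nonneg: "\<And>j. j \<ge> 1 \<Longrightarrow> 0 \<le> f j" and lim: "filterlim f at_top sequentially"
  shows "filterlim (\<lambda>n. (\<Sum>j=1..n. f j) / real n) at_top sequentially"
  unfolding filterlim_at_top_gt[where c = 0]
proof (intro allI impI)
  fix Z :: real assume Z: "Z > 0"
  obtain m where m: "\<And>j. j \<ge> m \<Longrightarrow> 2 * Z \<le> f j"
    using lim unfolding filterlim_at_top eventually_sequentially by blast
  show "eventually (\<lambda>n. Z \<le> (\<Sum>j=1..n. f j) / real n) sequentially"
    using eventually_ge_at_top[of "2 * Suc m"]
  proof eventually_elim
    case (elim n)
    have "Z * real n \<le> real (n - m) * (2 * Z)"
      using elim Z by (simp add: of_nat_diff algebra_simps flip: of_nat_le_iff)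
    also have "\<dots> = (\<Sum>j\<in>{Suc m..n}. 2 * Z)"
      by simp
    also have "\<dots> \<le> (\<Sum>j\<in>{Suc m..n}. f j)"
      by (intro sum_mono m) simp
    also have "\<dots> \<le> (\<Sum>j=1..n. f j)"
      by (intro sum_mono2) (auto simp: nonneg)
    finally show ?case
      using elim by (simp add: pos_le_divide_eq)
  qed
qed

text \<open>Monotonicity of \<open>f\<close> is log-convexity, \<open>0 \<le> f 1\<close> is the
  normalisation, and divergence of \<open>f\<close> passes to its means, which are the logarithms of
  the roots.\<close>

lemma exp_sum_in_LC:
  assumes mono: "\<And>j. j \<ge> 1 \<Longrightarrow> f j \<le> f (Suc j)" and nonneg: "0 \<le> f 1"
    and lim: "filterlim f at_top sequentially"
  shows "exp_sum f \<in> LC"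
proof -
  have "f 1 \<le> f j" if "j \<ge> 1" for j
    using that
  proof (induction j rule: dec_induct)
    case (step j)
    then show ?case using mono[of j] by simp
  qed simp
  then have f_nonneg: "0 \<le> f j" if "j \<ge> 1" for j
    using nonneg that by force
  have "filterlim (\<lambda>p. exp ((\<Sum>j=1..p. f j) / real p)) at_top sequentially"
    by (rule filterlim_compose[OF exp_at_top filterlim_mean_at_top[OF f_nonneg lim]])
  then have root: "filterlim (\<lambda>p. exp_sum f p powr (1 / real p)) at_top sequentially"
    by (simp only: root_exp_sum)
  have "(exp_sum f p)\<^sup>2 \<le> exp_sum f (p - 1) * exp_sum f (p + 1)" if p: "p \<ge> 1" for p
  proof -
    obtain k where k: "p = Suc k" using p by (cases p) auto
    have "f (Suc k) \<le> f (Suc (Suc k))" by (rule mono) simp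
    then show ?thesis
      by (simp add: k exp_sum_def power2_eq_square flip: exp_add)
  qed
  then show ?thesis
    using root nonneg by (auto simp: LC_def exp_sum_def)
qed

section \<open>The plateau function and its jumps\<close>

text \<open>\<open>plateau\<close> is a step function which, at a jump \<open>q\<close>, takes the value \<open>q\<close> and keeps it for at
  least \<open>exp (q\<^sup>2)\<close> indices.\<close>

primrec plateau :: "nat \<Rightarrow> nat" where
  "plateau 0 = 0"
| "plateau (Suc p) =
    (if real (plateau p) + exp ((real (plateau p))\<^sup>2) \<le> real (Suc p) then Suc p else plateau p)"

definition jump :: "nat \<Rightarrow> bool" where
  "jump q \<longleftrightarrow> (\<exists>k. q = Suc k \<and> real (plateau k) + exp ((real (plateau k))\<^sup>2) \<le> real (Suc k))"

lemma plateau_le: "plateau p \<le> p"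
  by (induction p) auto

lemma plateau_Suc_mono: "plateau p \<le> plateau (Suc p)"
  using plateau_le[of p] by simp

lemma plateau_mono: "m \<le> n \<Longrightarrow> plateau m \<le> plateau n"
  using plateau_Suc_mono by (rule lift_Suc_mono_le)

text \<open>Without jumps beyond \<open>n\<close> the value would stay constant, and the index would
  eventually pass the fixed threshold for a jump.\<close>

lemma exists_jump: "\<exists>q\<ge>n. jump q"
proof (rule ccontr)
  assume contra: "\<not> (\<exists>q\<ge>n. jump q)"
  have const: "plateau p = plateau n" if "p \<ge> n" for p
    using that
  proof (induction p rule: dec_induct)
    case (step k)
    then have "\<not> jump (Suc k)" using contra by simp
    then show ?case using step by (auto simp: jump_def)
  qed simp
  obtain k where k: "real (plateau n) + exp ((real (plateau n))\<^sup>2) \<le> real k"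
    using real_arch_simple by blast
  have "plateau (max k n) = plateau n" by (rule const) simp
  then have "jump (Suc (max k n))"
    using k by (auto simp: jump_def)
  then show False using contra by (meson le_SucI max.cobounded2)
qed

lemma plateau_after_jump:
  assumes "jump q" "q \<le> j" "real j < real q + exp ((real q)\<^sup>2)"
  shows "plateau j = q"
  using assms(2,3)
proof (induction j rule: dec_induct)
  case base
  then show ?case using assms(1) by (auto simp: jump_def)
next
  case (step j)
  then show ?case by auto
qed

text \<open>The threshold forces \<open>exp (v^2) \<le> q\<close> for the value \<open>v\<close>
  just before the jump. The resulting bound \<open>q\<close>, though crude, is small against the
  value \<open>q^2\<close> taken after the jump.\<close>

lemma plateau_before_jump:
  assumes "jump q" "j < q"
  shows "(real (plateau j))\<^sup>2 \<le> real q"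
proof -
  obtain k where k: "q = Suc k" "real (plateau k) + exp ((real (plateau k))\<^sup>2) \<le> real q"
    using assms(1) by (auto simp: jump_def)
  have "(real (plateau j))\<^sup>2 \<le> (real (plateau k))\<^sup>2"
    using plateau_mono[of j k] assms(2) k(1) by (intro power_mono) auto
  also have "\<dots> \<le> exp ((real (plateau k))\<^sup>2)"
    using exp_ge_add_one_self[of "(real (plateau k))\<^sup>2"] by linarith
  also have "\<dots> \<le> real q" using k(2) by linarith
  finally show ?thesis .
qed

lemma filterlim_plateau: "filterlim plateau at_top sequentially"
  unfolding filterlim_at_top eventually_sequentially
proof
  fix Z
  obtain q where q: "q \<ge> Z" "jump q" using exists_jump by blast
  then have "plateau q = q" using plateau_after_jump[of q q] by simp
  then have "Z \<le> plateau n" if "n \<ge> q" for n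
    using plateau_mono[OF that] q by simp
  then show "\<exists>N. \<forall>n\<ge>N. Z \<le> plateau n" by blast
qed

section \<open>The counterexamples and their growth\<close>

text \<open>The square makes the gap at a jump \<open>q\<close> quadratic in \<open>q\<close>,
  beyond the term \<open>2 * q * ln C\<close> that the weak condition allows.\<close>

definition log_quot :: "real \<Rightarrow> nat \<Rightarrow> real" where
  "log_quot c p = c * ln (real p) + (real (plateau p))\<^sup>2"

definition plateau_seq :: "real \<Rightarrow> nat \<Rightarrow> real" where
  "plateau_seq c = exp_sum (log_quot c)"

lemma plateau_seq_in_LC:
  assumes "c \<ge> 0"
  shows "plateau_seq c \<in> LC"
  unfolding plateau_seq_def
proof (rule exp_sum_in_LC)
  show "log_quot c j \<le> log_quot c (Suc j)" if "j \<ge> 1" for j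
    unfolding log_quot_def using that assms plateau_Suc_mono[of j]
    by (intro add_mono mult_left_mono power_mono) (auto simp del: plateau.simps)
  show "0 \<le> log_quot c 1" by (simp add: log_quot_def)
  show "filterlim (log_quot c) at_top sequentially"
  proof (rule filterlim_at_top_mono)
    show "filterlim (\<lambda>p. real (plateau p)) at_top sequentially"
      by (rule filterlim_compose[OF filterlim_real_sequentially filterlim_plateau])
    have "real (plateau p) \<le> log_quot c p" if "p \<ge> 1" for p
    proof -
      have "real (plateau p) \<le> real ((plateau p)\<^sup>2)"
        by (simp only: of_nat_le_iff) (simp add: power2_eq_square)
      also have "\<dots> \<le> log_quot c p"
        using that assms by (simp add: log_quot_def)
      finally show ?thesis .
    qed
    then show "eventually (\<lambda>p. real (plateau p) \<le> log_quot c p) sequentially"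
      unfolding eventually_sequentially by blast
  qed
qed

text \<open>At a jump \<open>q\<close> a fraction of about \<open>1/d\<close> of the first \<open>d q\<close> logarithmic quotients is still
  at most \<open>q\<close> up to the logarithmic part, so that their mean stays below the value at \<open>q\<close> by
  about \<open>q\<^sup>2 / d\<close>.\<close>

lemma log_quot_gap_at_jump:
  assumes c: "c \<ge> 0" and q: "jump q" "d \<le> q" and d: "d > 0"
  shows "(\<Sum>j=1..d * q. log_quot c j) / real (d * q)
    \<le> log_quot c q + c * ln (real d) - (real q - 1)\<^sup>2 / real d"
proof -
  have q0: "q > 0" using q d by simp
  have le: "log_quot c j \<le> c * ln (real (d * q)) + (real q)\<^sup>2 - (if j < q then (real q)\<^sup>2 - real q else 0)"
    if j: "j \<in> {1..d * q}" for j
  proof -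
    have "ln (real j) \<le> ln (real (d * q))"
      using j by (intro ln_mono) (auto simp flip: of_nat_mult)
    then have log: "c * ln (real j) \<le> c * ln (real (d * q))"
      using c by (rule mult_left_mono)
    show ?thesis
    proof (cases "j < q")
      case True
      then show ?thesis
        using plateau_before_jump[OF q(1) True] log unfolding log_quot_def if_P[OF True] by linarith
    next
      case False
      \<comment> \<open>The hypothesis \<open>d \<le> q\<close> keeps all indices up to
        \<open>d * q\<close> on the plateau begun at \<open>q\<close>, as
        \<open>q^2 < exp (q^2)\<close>.\<close>
      have "real j \<le> real (d * q)"
        using j by (simp only: of_nat_le_iff atLeastAtMost_iff)
      also have "\<dots> \<le> real (q * q)" using q(2) by (simp only: of_nat_le_iff mult_le_mono1)
      also have "\<dots> < exp ((real q)\<^sup>2)"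
        using exp_ge_add_one_self[of "(real q)\<^sup>2"] unfolding of_nat_mult power2_eq_square by linarith
      finally have "plateau j = q"
        using plateau_after_jump[OF q(1), of j] False by simp
      then show ?thesis using False log by (simp add: log_quot_def)
    qed
  qed
  have "{1..d * q} \<inter> {j. j < q} = {1..<q}"
  proof -
    have "q \<le> d * q" using d by simp
    then obtain r where "d * q = q + r" using le_Suc_ex by blast
    then show ?thesis by auto
  qed
  \<comment> \<open>The saving equals \<open>q * (q - 1)^2\<close>; divided by \<open>d * q\<close>
    it becomes the subtracted term of the claim.\<close>
  then have below: "(\<Sum>j=1..d * q. if j < q then (real q)\<^sup>2 - real q else 0)
      = (real q - 1) * ((real q)\<^sup>2 - real q)"
    using q0 by (simp add: sum.If_cases of_nat_diff)
  have "(\<Sum>j=1..d * q. log_quot c j) \<le>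
      (\<Sum>j=1..d * q. c * ln (real (d * q)) + (real q)\<^sup>2 - (if j < q then (real q)\<^sup>2 - real q else 0))"
    by (intro sum_mono le)
  also have "\<dots> = real (d * q) * (c * ln (real (d * q)) + (real q)\<^sup>2) - (real q - 1) * ((real q)\<^sup>2 - real q)"
    by (simp only: sum_subtractf below) simp
  also have "\<dots> = (log_quot c q + c * ln (real d) - (real q - 1)\<^sup>2 / real d) * real (d * q)"
  proof -
    have "plateau q = q" using plateau_after_jump[OF q(1), of q] by simp
    then show ?thesis
      using d q0 by (simp add: log_quot_def ln_mult power2_eq_square field_simps)
  qed
  finally show ?thesis
    using d q0 by (simp add: pos_divide_le_eq)
qed

text \<open>At a jump \<open>q\<close>, the condition and the gap estimate together bound
  \<open>(q - 1)^2\<close> by \<open>a + b * q\<close>, which fails for large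
  \<open>q\<close>.\<close>

lemma plateau_seq_not_weak_quot_root_cond:
  assumes c: "c \<ge> 0"
  shows "\<not> weak_quot_root_cond (plateau_seq c)"
proof
  assume "weak_quot_root_cond (plateau_seq c)"
  then obtain d A C where d: "d > 0" and A: "A \<ge> 1" and C: "C \<ge> 1" and
    bound: "\<And>p. p > 0 \<Longrightarrow> quot (plateau_seq c) p \<le>
      A * C ^ (2 * p) * plateau_seq c (d * p) powr (1 / real (d * p))"
    unfolding weak_quot_root_cond_def by blast
  define a where "a = real d * (ln A + c * ln (real d))"
  define b where "b = real d * (2 * ln C)"
  have a: "a \<ge> 0" and b: "b \<ge> 0" using d A C c by (simp_all add: a_def b_def)
  \<comment> \<open>The bound \<open>q \<ge> d\<close> serves the gap estimate;
    \<open>q \<ge> a + b + 3\<close> yields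
    \<open>(a + b) * q \<le> (q - 3) * q < (q - 1)^2\<close>.\<close>
  obtain q where q: "q \<ge> max d (nat \<lceil>a + b + 3\<rceil>)" "jump q" using exists_jump by blast
  have q0: "q > 0" using q d by simp
  have q3: "real q \<ge> a + b + 3"
    using q(1) real_nat_ceiling_ge[of "a + b + 3"] by linarith
  have "exp (log_quot c q) \<le>
      A * C ^ (2 * q) * exp ((\<Sum>j=1..d * q. log_quot c j) / real (d * q))"
    using bound[OF q0] q0 by (simp only: plateau_seq_def quot_exp_sum root_exp_sum)
  also have "\<dots> = exp (ln A + real (2 * q) * ln C + (\<Sum>j=1..d * q. log_quot c j) / real (d * q))"
  proof -
    have "exp (real (2 * q) * ln C) = C ^ (2 * q)"
      by (subst exp_of_nat_mult) (use C in simp)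
    then show ?thesis using A by (simp only: exp_add) simp
  qed
  finally have "log_quot c q \<le> ln A + real (2 * q) * ln C + (\<Sum>j=1..d * q. log_quot c j) / real (d * q)"
    by (simp only: exp_le_cancel_iff)
  also have "\<dots> \<le> ln A + real (2 * q) * ln C + (log_quot c q + c * ln (real d) - (real q - 1)\<^sup>2 / real d)"
    using q by (intro add_left_mono log_quot_gap_at_jump c d) auto
  finally have "(real q - 1)\<^sup>2 / real d \<le> ln A + real (2 * q) * ln C + c * ln (real d)"
    by simp
  then have "(real q - 1)\<^sup>2 \<le> a + b * real q"
    using d by (simp add: a_def b_def pos_divide_le_eq algebra_simps)
  also have "\<dots> \<le> a * real q + b * real q"
    using mult_left_mono[of 1 "real q" a] a q0 by simp
  also have "\<dots> \<le> (real q - 3) * real q"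
    unfolding distrib_right[symmetric] using q3 by (intro mult_right_mono) auto
  also have "\<dots> < (real q - 1)\<^sup>2"
    using q0 by (simp add: power2_eq_square algebra_simps)
  finally show False by simp
qed

lemma quot_root_cond_imp_weak:
  assumes "quot_root_cond N"
  shows "weak_quot_root_cond N"
  using assms unfolding quot_root_cond_def weak_quot_root_cond_def
  by (metis mult.right_neutral order_refl power_one)

lemma plateau_seq_not_quot_root_cond: "c \<ge> 0 \<Longrightarrow> \<not> quot_root_cond (plateau_seq c)"
  using plateau_seq_not_weak_quot_root_cond quot_root_cond_imp_weak by blast

text \<open>For \<open>Q = 2\<close> the factor \<open>p^2\<close> of the quotients contributes the
  ratio \<open>4 > 2\<close>, and the plateau term, being increasing, can only enlarge it.\<close>

lemma plateau_seq_strongly_nonquasianalytic: "strongly_nonquasianalytic (plateau_seq 2)"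
proof -
  have "4 \<le> quot (plateau_seq 2) (2 * p) / quot (plateau_seq 2) p" if p: "p \<ge> 1" for p
  proof -
    have "(real (plateau p))\<^sup>2 \<le> (real (plateau (2 * p)))\<^sup>2"
      using plateau_mono[of p "2 * p"] by (intro power_mono) auto
    then have "2 * ln 2 \<le> log_quot 2 (2 * p) - log_quot 2 p"
      using p by (simp add: log_quot_def ln_mult)
    then have "exp (2 * ln 2) \<le> exp (log_quot 2 (2 * p) - log_quot 2 p)"
      by (simp only: exp_le_cancel_iff)
    moreover have "exp (2 * ln 2) = (4 :: real)"
      using exp_of_nat_mult[of 2 "ln 2 :: real"] by simp
    ultimately show ?thesis
      using p by (simp add: plateau_seq_def quot_exp_sum exp_diff)
  qed
  then have "ereal 4 \<le> liminf (\<lambda>p. ereal (quot (plateau_seq 2) (2 * p) / quot (plateau_seq 2) p))"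
    by (intro Liminf_bounded) (auto simp: eventually_sequentially)
  then have "ereal (real 2) < liminf (\<lambda>p. ereal (quot (plateau_seq 2) (2 * p) / quot (plateau_seq 2) p))"
    by (rule less_le_trans[rotated]) simp
  then show ?thesis
    unfolding strongly_nonquasianalytic_def by blast
qed

text \<open>The plateau at a jump \<open>q\<close> has at least \<open>exp (q^2)\<close> indices,
  each contributing \<open>exp (-(q^2))\<close>, so every jump adds at least 1 to the sum.\<close>

lemma plateau_seq_quasianalytic: "quasianalytic (plateau_seq 0)"
proof -
  define S where "S n = (\<Sum>p=1..n. 1 / quot (plateau_seq 0) p)" for n
  have quot: "1 / quot (plateau_seq 0) p = exp (- (real (plateau p))\<^sup>2)" if "p \<ge> 1" for p
    using that by (simp add: plateau_seq_def quot_exp_sum log_quot_def exp_minus inverse_eq_divide)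
  have S_eq: "S n = (\<Sum>p=1..n. exp (- (real (plateau p))\<^sup>2))" for n
    unfolding S_def by (intro sum.cong quot) auto
  have S_mono: "S m \<le> S n" if "m \<le> n" for m n
    unfolding S_eq using that by (intro sum_mono2) auto
  have unbounded: "\<exists>n. real k \<le> S n" for k
  proof (induction k)
    case 0
    show ?case by (rule exI[of _ 0]) (simp add: S_def)
  next
    case (Suc k)
    then obtain n where n: "real k \<le> S n" by blast
    \<comment> \<open>Starting beyond \<open>n\<close> keeps the new block disjoint from the terms
      already counted.\<close>
    obtain q where q: "q \<ge> Suc n" "jump q" using exists_jump by blast
    define l where "l = nat \<lceil>exp ((real q)\<^sup>2)\<rceil>"
    have l: "exp ((real q)\<^sup>2) \<le> real l" "real l < exp ((real q)\<^sup>2) + 1"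
      unfolding l_def using exp_gt_zero[of "(real q)\<^sup>2"] by linarith+
    have "1 = exp ((real q)\<^sup>2) * exp (- (real q)\<^sup>2)"
      by (simp flip: exp_add)
    also have "\<dots> \<le> real l * exp (- (real q)\<^sup>2)"
      using l(1) by (intro mult_right_mono) auto
    also have "\<dots> = (\<Sum>p\<in>{q..<q + l}. exp (- (real q)\<^sup>2))"
      by simp
    also have "\<dots> = (\<Sum>p\<in>{q..<q + l}. exp (- (real (plateau p))\<^sup>2))"
    proof (intro sum.cong refl)
      fix p assume p: "p \<in> {q..<q + l}"
      \<comment> \<open>Although \<open>l\<close> is rounded up, the last index
        \<open>q + l - 1\<close> stays below \<open>q + exp (q^2)\<close>.\<close>
      then have "real p + 1 \<le> real q + real l"
        by (simp flip: of_nat_add of_nat_Suc add: Suc_le_eq)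
      then have "plateau p = q"
        using p l(2) by (intro plateau_after_jump q(2)) auto
      then show "exp (- (real q)\<^sup>2) = exp (- (real (plateau p))\<^sup>2)" by simp
    qed
    finally have "real k + 1 \<le> S n + (\<Sum>p\<in>{q..<q + l}. exp (- (real (plateau p))\<^sup>2))"
      using n by linarith
    also have "\<dots> = (\<Sum>p\<in>{1..n} \<union> {q..<q + l}. exp (- (real (plateau p))\<^sup>2))"
      unfolding S_eq using q(1) by (intro sum.union_disjoint[symmetric]) auto
    also have "\<dots> \<le> S (q + l)"
      unfolding S_eq using q(1) by (intro sum_mono2) auto
    finally show ?case by (auto simp: add.commute)
  qed
  have "filterlim S at_top sequentially"
    unfolding filterlim_at_top eventually_sequentially
  proof
    fix Z :: real
    obtain k where k: "Z \<le> real k" using real_arch_simple by blast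
    obtain n where "real k \<le> S n" using unbounded by blast
    then show "\<exists>N. \<forall>n\<ge>N. Z \<le> S n"
      using k S_mono by (meson order_trans)
  qed
  then show ?thesis by (simp add: quasianalytic_def S_def[abs_def])
qed

section \<open>The moderate growth index and the combination of all claims\<close>

lemma mg_index_infinite_iff: "mg_index N = \<infinity> \<longleftrightarrow> \<not> quot_root_cond N"
  unfolding mg_index_def quot_root_cond_def quot_root_at_def[symmetric] by simp

theorem theorem4p8:
  shows
    "(\<exists>N\<in>LC. \<not> quot_root_cond N \<and> mg_index N = \<infinity> \<and>
        \<not> quot_root_Roumieu (weight_matrix (assoc_weight N)) \<and>
        \<not> quot_root_Beurling (weight_matrix (assoc_weight N)) \<and>
        \<not> moderate_growth N \<and>
        \<not> constant_matrix (weight_matrix (assoc_weight N)))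
   \<and> (\<forall>N\<in>LC.
        (\<not> quot_root_cond N \<longleftrightarrow> mg_index N = \<infinity>) \<and>
        (\<not> quot_root_cond N \<longleftrightarrow> \<not> quot_root_Roumieu (weight_matrix (assoc_weight N))) \<and>
        (\<not> quot_root_cond N \<longleftrightarrow> \<not> quot_root_Beurling (weight_matrix (assoc_weight N))) \<and>
        (\<not> quot_root_cond N \<longrightarrow> \<not> moderate_growth N) \<and>
        (\<not> moderate_growth N \<longleftrightarrow> \<not> constant_matrix (weight_matrix (assoc_weight N))))
   \<and> (\<exists>N\<in>LC. \<not> quot_root_cond N \<and> strongly_nonquasianalytic N)
   \<and> (\<forall>N\<in>LC. \<not> quot_root_cond N \<and> strongly_nonquasianalytic N
        \<longrightarrow> strong_weight (assoc_weight N))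
   \<and> (\<exists>N\<in>LC. \<not> quot_root_cond N \<and> quasianalytic N)
   \<and> (\<exists>N\<in>LC. \<not> quot_root_cond N \<and> \<not> weak_quot_root_cond N)"
proof -
  have equiv: "\<forall>N\<in>LC.
        (\<not> quot_root_cond N \<longleftrightarrow> mg_index N = \<infinity>) \<and>
        (\<not> quot_root_cond N \<longleftrightarrow> \<not> quot_root_Roumieu (weight_matrix (assoc_weight N))) \<and>
        (\<not> quot_root_cond N \<longleftrightarrow> \<not> quot_root_Beurling (weight_matrix (assoc_weight N))) \<and>
        (\<not> quot_root_cond N \<longrightarrow> \<not> moderate_growth N) \<and>
        (\<not> moderate_growth N \<longleftrightarrow> \<not> constant_matrix (weight_matrix (assoc_weight N)))"
    using mg_index_infinite_iff quot_root_cond_iff_Roumieu quot_root_cond_iff_Beurling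
      moderate_growth_imp_quot_root_cond moderate_growth_iff_constant_matrix by metis
  \<comment> \<open>The parameter 0 serves the quasianalytic example and (b), the parameter 2 the
    strongly non-quasianalytic one.\<close>
  have in_LC: "plateau_seq 0 \<in> LC" "plateau_seq 2 \<in> LC"
    by (simp_all add: plateau_seq_in_LC)
  have not_cond: "\<not> quot_root_cond (plateau_seq 0)" "\<not> quot_root_cond (plateau_seq 2)"
    by (simp_all add: plateau_seq_not_quot_root_cond)
  show ?thesis
  proof (intro conjI)
    show "\<exists>N\<in>LC. \<not> quot_root_cond N \<and> mg_index N = \<infinity> \<and>
        \<not> quot_root_Roumieu (weight_matrix (assoc_weight N)) \<and>
        \<not> quot_root_Beurling (weight_matrix (assoc_weight N)) \<and>
        \<not> moderate_growth N \<and>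
        \<not> constant_matrix (weight_matrix (assoc_weight N))"
      using equiv in_LC(1) not_cond(1) by meson
    show "\<forall>N\<in>LC. \<not> quot_root_cond N \<and> strongly_nonquasianalytic N
        \<longrightarrow> strong_weight (assoc_weight N)"
      using strong_weight_assoc_weight by blast
    show "\<exists>N\<in>LC. \<not> quot_root_cond N \<and> strongly_nonquasianalytic N"
      using in_LC(2) not_cond(2) plateau_seq_strongly_nonquasianalytic by blast
    show "\<exists>N\<in>LC. \<not> quot_root_cond N \<and> quasianalytic N"
      using in_LC(1) not_cond(1) plateau_seq_quasianalytic by blast
    show "\<exists>N\<in>LC. \<not> quot_root_cond N \<and> \<not> weak_quot_root_cond N"
      using in_LC(1) not_cond(1) plateau_seq_not_weak_quot_root_cond[of 0] by auto
  qed (rule equiv)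
qed

end
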